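(* Let $\mathcal{T}\in\mathbb{R}^{n_1\times n_2\times n_3}$ have a CP-decomposition $\mathcal{T}=[[\mathbf{A}^{(1)},\mathbf{A}^{(2)},\mathbf{A}^{(3)}]]$ with factor matrices $\mathbf{A}^{(k)}\in\mathbb{R}^{n_k\times r}$. Let $s\ge 1$ be an integer, $\delta\in(0,1)$ and $\mu_0>0$. Suppose that (a) $\mu(\mathbf{A}^{(1)})\le\mu_0$; (b) $\operatorname{rank}(\mathbf{A}^{(1)})=\operatorname{rank}(\mathbf{A}^{(2)})=r$; (c) every $s\times r$ submatrix of $\mathbf{A}^{(3)}$ has Kruskal rank $\ge 2$. Then, with probability at least $1-s\delta$, the Adaptive Tensor Sandwich algorithm for order-3 tensors (described in the context) completes $\mathcal{T}$, i.e. recovers factor matrices whose CP tensor equals $\mathcal{T}$, and uses at most $$O\left(s\mu_0 n_2 r\log(r/\delta)\right)+s n_1 r+n_3 r$$ samples (observed entries) of $\mathcal{T}$.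
   Context: Notation: $[n]=\{1,\dots,n\}$. For factor matrices $\mathbf{A}^{(k)}\in\mathbb{R}^{n_k\times r}$ with columns $\mathbf{a}^{(k)}_\ell$, $[[\mathbf{A}^{(1)},\dots,\mathbf{A}^{(d)}]]=\sum_{\ell=1}^r\mathbf{a}^{(1)}_\ell\circ\cdots\circ\mathbf{a}^{(d)}_\ell$ ($\circ$ = outer product). Coherence: for an $n\times r$ matrix $\mathbf{M}$, $\mu(\mathbf{M})=\frac{n}{r}\max_{i\in[n]}\|\mathrm{proj}_{\mathrm{col}(\mathbf{M})}\mathbf{e}_i\|_2^2$, where $\mathbf{e}_i$ is the $i$-th standard basis vector. The Kruskal rank of a matrix is the largest $k$ such that every set of $k$ columns is linearly independent. The Khatri–Rao product $\mathbf{A}^{(1)}\odot\mathbf{A}^{(2)}\in\mathbb{R}^{n_1n_2\times r}$ has the row indexed by $(i_1,i_2)$ equal to the entrywise product of row $i_1$ of $\mathbf{A}^{(1)}$ and row $i_2$ of $\mathbf{A}^{(2)}$. Subroutines. (i) Adaptive matrix completion (Balcan–Zhang 2016) of $\mathbf{M}\in\mathbb{R}^{n_1\times n_2}$ with parameters $\mu_0,r,\delta$: process the columns one at a time, maintaining a matrix $\mathbf{B}$ (initially empty) whose columns are fully observed columns; a random set $\Lambda\subset[n_1]$ of $w=\min\{\lceil C\mu_0 r\log(r/\delta)\rceil,n_1\}$ rows is drawn ($C$ an absolute constant); for column $i$, observe $\mathbf{M}_{\Lambda,i}$; if $\mathbf{M}_{\Lambda,i}\in\mathrm{col}(\mathbf{B}_{\Lambda,:})$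 set $\mathbf{M}_{:,i}=\mathbf{B}\mathbf{B}_{\Lambda,:}^\dagger\mathbf{M}_{\Lambda,i}$, otherwise observe the whole column, append it to $\mathbf{B}$ and redraw $\Lambda$. (ii) Jennrich's algorithm on $\mathcal{X}\in\mathbb{R}^{n_1\times n_2\times s}$: draw random $\mathbf{u},\mathbf{v}\in\mathbb{R}^s$, form $\mathbf{X}_\mathbf{u}=\sum_{j}u_j\mathcal{X}_{:,:,j}$, $\mathbf{X}_\mathbf{v}=\sum_j v_j\mathcal{X}_{:,:,j}$, compute eigenvectors of $\mathbf{X}_\mathbf{u}\mathbf{X}_\mathbf{v}^\dagger$ and of $\mathbf{X}_\mathbf{v}\mathbf{X}_\mathbf{u}^\dagger$ (nonzero eigenvalues) and pair eigenvectors whose eigenvalues are reciprocal, giving paired columns of the mode-1 and mode-2 factors. Algorithm (Adaptive Tensor Sandwich, order 3): (1) pick any $S\subset[n_3]$ with $|S|=s$; (2) for each $i_3\in S$, sample and complete the slice $\mathcal{T}_{:,:,i_3}$ with the adaptive matrix completion subroutine; (3) apply Jennrich's algorithm to the completed $\mathcal{T}_{:,:,S}$ to obtain $\mathbf{A}^{(1)},\mathbf{A}^{(2)}$; (4) perform QR decomposition with pivoting on $(\mathbf{A}^{(1)}\odot\mathbf{A}^{(2)})^T$ to identify $r$ linearly independent rows of $\mathbf{A}^{(1)}\odot\mathbf{A}^{(2)}$, and let $L\subset[n_1]\times[n_2]$ be the corresponding indices; (5) for each $i_3\in[n_3]$, sample $\mathcal{T}_{i_1,i_2,i_3}$ for $(i_1,i_2)\in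 L$ and solve $\sum_{\ell=1}^r\mathbf{A}^{(1)}_{i_1,\ell}\mathbf{A}^{(2)}_{i_2,\ell}\mathbf{A}^{(3)}_{i_3,\ell}=\mathcal{T}_{i_1,i_2,i_3}$, $(i_1,i_2)\in L$, for the row $\mathbf{A}^{(3)}_{i_3,:}$; return $\mathbf{A}^{(1)},\mathbf{A}^{(2)},\mathbf{A}^{(3)}$.
   Formalization: Jennrich's second matrix X_v X_u^† (its eigenvectors lie in col(A1), so it cannot give A2) is replaced by X_v^T (X_u^T)^†; u, v are Gaussian; the O-term uses ⌈μ0 r log(r/δ)⌉, the same up to a constant since r≥2 and μ0≥1. *)

theory Defs
  imports "HOL-Probability.Probability"
    "Jordan_Normal_Form.Char_Poly"
    "Jordan_Normal_Form.DL_Rank_Submatrix"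
begin

definition mrank :: "real mat \<Rightarrow> nat" where
  "mrank A = vec_space.rank (dim_row A) A"

definition col_sp :: "real mat \<Rightarrow> real vec set" where
  "col_sp M = {M *\<^sub>v c | c. c \<in> carrier_vec (dim_col M)}"

definition proj_col :: "real mat \<Rightarrow> real vec \<Rightarrow> real vec" where
  "proj_col M x = (THE y. y \<in> col_sp M \<and> (\<forall>z \<in> col_sp M. (x - y) \<bullet> z = 0))"

definition coherence :: "real mat \<Rightarrow> real" where
  "coherence M = real (dim_row M) / real (dim_col M) *
     Max {(proj_col M (unit_vec (dim_row M) i)) \<bullet> (proj_col M (unit_vec (dim_row M) i)) | i. i < dim_row M}"

definition kruskal_rank :: "real mat \<Rightarrow> nat" where
  "kruskal_rank A = (GREATEST k. k \<le> dim_col A \<and>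
     (\<forall>J. J \<subseteq> {..<dim_col A} \<and> card J = k \<longrightarrow> mrank (submatrix A UNIV J) = k))"

definition pinv :: "real mat \<Rightarrow> real mat" where
  "pinv A = (THE X. X \<in> carrier_mat (dim_col A) (dim_row A) \<and> A * X * A = A \<and> X * A * X = X \<and>
      (A * X)\<^sup>T = A * X \<and> (X * A)\<^sup>T = X * A)"

definition cp3 :: "real mat \<Rightarrow> real mat \<Rightarrow> real mat \<Rightarrow> nat \<Rightarrow> nat \<Rightarrow> nat \<Rightarrow> real" where
  "cp3 A1 A2 A3 i1 i2 i3 = (\<Sum>l < dim_col A1. A1 $$ (i1, l) * A2 $$ (i2, l) * A3 $$ (i3, l))"

section \<open>Adaptive matrix completion (Balcan--Zhang)\<close>

text \<open>State: (B as list of fully observed columns, index of current draw of Lambda,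
  completed columns so far, set of observed entries (row, column)).
  Lams k is the k-th random draw of the row set Lambda.\<close>
definition amc_step :: "nat \<Rightarrow> (nat \<Rightarrow> nat \<Rightarrow> real) \<Rightarrow> (nat \<Rightarrow> nat set) \<Rightarrow>
    real vec list \<times> nat \<times> real vec list \<times> (nat \<times> nat) set \<Rightarrow> nat \<Rightarrow>
    real vec list \<times> nat \<times> real vec list \<times> (nat \<times> nat) set" where
  "amc_step n1 M Lams st i = (case st of (Bs, k, cs, obs) \<Rightarrow>
     let Lam = Lams k; idx = sorted_list_of_set Lam; m = length idx;
         BL = mat m (length Bs) (\<lambda>(a, j). (Bs ! j) $ (idx ! a));
         ML = vec m (\<lambda>a. M (idx ! a) i);
         obs' = obs \<union> {(a, i) | a. a \<in> Lam}
     in if ML \<in> col_sp BL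
        then (Bs, k, cs @ [mat_of_cols n1 Bs *\<^sub>v (pinv BL *\<^sub>v ML)], obs')
        else (let c = vec n1 (\<lambda>a. M a i)
              in (Bs @ [c], Suc k, cs @ [c], obs' \<union> {(a, i) | a. a < n1})))"

definition amc :: "nat \<Rightarrow> nat \<Rightarrow> (nat \<Rightarrow> nat \<Rightarrow> real) \<Rightarrow> (nat \<Rightarrow> nat set) \<Rightarrow>
    real mat \<times> (nat \<times> nat) set" where
  "amc n1 n2 M Lams = (case foldl (amc_step n1 M Lams) ([], 0, [], {}) [0..<n2] of
     (Bs, k, cs, obs) \<Rightarrow> (mat n1 n2 (\<lambda>(a, i). (cs ! i) $ a), obs))"

definition amc_w :: "real \<Rightarrow> real \<Rightarrow> nat \<Rightarrow> real \<Rightarrow> nat \<Rightarrow> nat" where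
  "amc_w C mu0 r \<delta> n1 = min (nat \<lceil>C * mu0 * real r * ln (real r / \<delta>)\<rceil>) n1"

definition slice_comb :: "nat \<Rightarrow> nat \<Rightarrow> nat \<Rightarrow> (nat \<Rightarrow> nat \<Rightarrow> nat \<Rightarrow> real) \<Rightarrow> (nat \<Rightarrow> real) \<Rightarrow> real mat" where
  "slice_comb n1 n2 s X u = mat n1 n2 (\<lambda>(i, j). \<Sum>k<s. u k * X i j k)"

definition jennrich_out :: "nat \<Rightarrow> nat \<Rightarrow> nat \<Rightarrow> (nat \<Rightarrow> nat \<Rightarrow> nat \<Rightarrow> real) \<Rightarrow>
    (nat \<Rightarrow> real) \<Rightarrow> (nat \<Rightarrow> real) \<Rightarrow> real mat \<Rightarrow> real mat \<Rightarrow> bool" where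
  "jennrich_out n1 n2 s X u v B1 B2 = (
     let Xu = slice_comb n1 n2 s X u; Xv = slice_comb n1 n2 s X v;
         M1 = Xu * pinv Xv; M2 = Xv\<^sup>T * pinv (Xu\<^sup>T)
     in \<exists>lams :: real list. distinct lams \<and>
          set lams = {lam. lam \<noteq> 0 \<and> (\<exists>x. eigenvector M1 x lam) \<and> (\<exists>y. eigenvector M2 y (1 / lam))} \<and>
          B1 \<in> carrier_mat n1 (length lams) \<and> B2 \<in> carrier_mat n2 (length lams) \<and>
          (\<forall>l < length lams. eigenvector M1 (col B1 l) (lams ! l) \<and>
                             eigenvector M2 (col B2 l) (1 / lams ! l)))"

text \<open>Linear independence of the rows of the Khatri--Rao product B1 (.) B2 indexed by L
  (as a family, so repeated rows count as dependent).\<close>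
definition kr_rows_indep :: "real mat \<Rightarrow> real mat \<Rightarrow> (nat \<times> nat) set \<Rightarrow> bool" where
  "kr_rows_indep B1 B2 L = (\<forall>d :: nat \<times> nat \<Rightarrow> real.
     (\<forall>l < dim_col B1. (\<Sum>(i1, i2) \<in> L. d (i1, i2) * (B1 $$ (i1, l) * B2 $$ (i2, l))) = 0)
     \<longrightarrow> (\<forall>p \<in> L. d p = 0))"

text \<open>Random seed: Lams (j, k) = k-th draw of Lambda while completing the j-th slice of S
  (slices taken in increasing order of their index in S); u, v for Jennrich.\<close>
type_synonym ats_seed = "((nat \<times> nat) \<Rightarrow> nat set) \<times> ((nat \<Rightarrow> real) \<times> (nat \<Rightarrow> real))"

definition ats_space :: "nat \<Rightarrow> nat \<Rightarrow> nat \<Rightarrow> ats_seed measure" where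
  "ats_space n1 w s =
     (PiM UNIV (\<lambda>_. measure_pmf (pmf_of_set {Lam. Lam \<subseteq> {..<n1} \<and> card Lam = w})))
     \<Otimes>\<^sub>M ((PiM {..<s} (\<lambda>_. density lborel std_normal_density))
          \<Otimes>\<^sub>M (PiM {..<s} (\<lambda>_. density lborel std_normal_density)))"

text \<open>A (nondeterministic) execution of the algorithm on the tensor T (accessed only through
  sampled entries), with slice set S, random seed om, producing factors (B1, B2, B3) and the set
  Obs of observed entries of T.\<close>
definition ats_exec :: "nat \<Rightarrow> nat \<Rightarrow> nat \<Rightarrow> nat \<Rightarrow> nat set \<Rightarrow> (nat \<Rightarrow> nat \<Rightarrow> nat \<Rightarrow> real) \<Rightarrow>
    ats_seed \<Rightarrow> real mat \<Rightarrow> real mat \<Rightarrow> real mat \<Rightarrow> (nat \<times> nat \<times> nat) set \<Rightarrow> bool" where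
  "ats_exec n1 n2 n3 w S T om B1 B2 B3 Obs = (case om of (Lams, (u, v)) \<Rightarrow>
     let s = card S; Sl = sorted_list_of_set S;
         res = (\<lambda>j. amc n1 n2 (\<lambda>a i. T a i (Sl ! j)) (\<lambda>k. Lams (j, k)));
         X = (\<lambda>i1 i2 j. fst (res j) $$ (i1, i2))
     in jennrich_out n1 n2 s X u v B1 B2 \<and>
        (\<exists>L. L \<subseteq> {..<n1} \<times> {..<n2} \<and> card L = dim_col B1 \<and> kr_rows_indep B1 B2 L \<and>
           B3 \<in> carrier_mat n3 (dim_col B1) \<and>
           (\<forall>i3 < n3. \<forall>(i1, i2) \<in> L.
              (\<Sum>l < dim_col B1. B1 $$ (i1, l) * B2 $$ (i2, l) * B3 $$ (i3, l)) = T i1 i2 i3) \<and>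
           Obs = (\<Union>j < s. {(a, i, Sl ! j) | a i. (a, i) \<in> snd (res j)})
                 \<union> {(i1, i2, i3) | i1 i2 i3. (i1, i2) \<in> L \<and> i3 < n3}))"

end

(*
Adaptive completion cannot go wrong as long as every sampled row set Lambda is
"determining": no nonzero vector of col(A1) vanishes on Lambda. Then at most r columns are observed
in full and every slice is completed exactly. To bound the failure probability, let D(Lambda) be the
largest size of an orthonormal family in col(A1) vanishing on Lambda, so D = 0 means determining.
An orthonormal family of size D puts mass at most kappa = mu0 r / n1 on each row, so at least
D / kappa rows outside Lambda decrease D when they are sampled next. Hence the mean of D shrinks by
the factor 1 - 1/(mu0 r) with each row, and is at most r exp(-w/(mu0 r)) after w rows; with C = 3 a
draw fails with probability at most r (delta/r)^3, and a union bound over the s (r + 1) relevant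
draws costs at most s delta because r >= 2 by the Kruskal rank condition.

With exact slices, X_u = A1 D_a A2^T and X_v = A1 D_b A2^T for diagonal D_a, D_b. By the Kruskal
rank condition the ratios a_l / b_l are defined, nonzero and distinct outside finitely many
hyperplanes, which are Gaussian null sets. They are then exactly the nonzero eigenvalues, with the
columns of A1 and A2 as eigenvectors up to scaling, and A3 is the solution of a square system.
*)
theory Submission
  imports Defs
begin

section \<open>Homogeneous linear systems\<close>

text \<open>The completion is adaptive: which draw is consulted, and against which columns, depends
  on earlier draws. Conditioning is avoided by asking of \<open>\<Lambda>\<close> a property of the
  whole of col(A1) instead of the columns at hand; a run then merely chooses which of the good draws
  it reads. A redraw occurs only when an independent column is appended, so the draw indices are 0
  to r, whence r + 1 draws per slice. A set \<open>\<Lambda>\<close> is drawn in one piece, not row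
  by row, so the decay of the mean of D comes from double counting. D is measured by orthonormal
  families because coherence concerns squared entries: the diagonal of a projector, whose trace is
  D. The algorithm is a relation, so the good event must give two things: some run exists, and every
  run is correct, whatever order and scaling of eigenvectors it returns. \<open>pinv\<close> is a
  definite description, which makes existence and uniqueness of the Moore-Penrose inverse part of
  the argument; existence is shown for products of full rank factors, the form of every matrix to
  which it is applied on the good event.\<close>

lemma underdetermined_system:
  fixes a :: "'i \<Rightarrow> 'j \<Rightarrow> real"
  assumes "finite I" "finite J" "card I < card J"
  shows "\<exists>d. (\<exists>j\<in>J. d j \<noteq> 0) \<and> (\<forall>i\<in>I. (\<Sum>j\<in>J. a i j * d j) = 0)"
  using assms
proof (induction I arbitrary: J a rule: finite_induct)
  case empty
  then obtain j where "j \<in> J" by (metis card.empty card_gt_0_iff ex_in_conv)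
  then show ?case by (intro exI[of _ "\<lambda>_. 1"]) auto
next
  case (insert i I)
  show ?case
  proof (cases "\<forall>j\<in>J. a i j = 0")
    case True
    have "card I < card J" using insert by simp
    from insert.IH[OF insert.prems(1) this, of a] obtain d where
      d: "\<exists>j\<in>J. d j \<noteq> 0" "\<forall>i\<in>I. (\<Sum>j\<in>J. a i j * d j) = 0" by blast
    with True show ?thesis by (intro exI[of _ d]) auto
  next
    case False
    then obtain p where p: "p \<in> J" "a i p \<noteq> 0" by blast
    let ?J = "J - {p}"
    have c: "card I < card ?J" using insert p by (simp add: card_Diff_singleton)
    have fJ: "finite ?J" using insert by simp
    \<comment> \<open>Gaussian elimination: equation \<open>i\<close> is solved for the unknown
      \<open>p\<close> and substituted into the others. Below, \<open>e\<close> adds back the value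
      at \<open>p\<close> that equation \<open>i\<close> dictates.\<close>
    from insert.IH[OF fJ c, of "\<lambda>k j. a k j - a k p * a i j / a i p"] obtain d where
      d: "\<exists>j\<in>?J. d j \<noteq> 0"
         "\<forall>k\<in>I. (\<Sum>j\<in>?J. (a k j - a k p * a i j / a i p) * d j) = 0" by blast
    define e where "e = d(p := - (\<Sum>j\<in>?J. a i j * d j) / a i p)"
    have split: "(\<Sum>j\<in>J. a k j * e j)
        = a k p * (- (\<Sum>j\<in>?J. a i j * d j) / a i p) + (\<Sum>j\<in>?J. a k j * d j)" for k
    proof -
      have "(\<Sum>j\<in>J. a k j * e j) = a k p * e p + (\<Sum>j\<in>?J. a k j * e j)"
        using insert p by (simp add: sum.remove)
      also have "(\<Sum>j\<in>?J. a k j * e j) = (\<Sum>j\<in>?J. a k j * d j)"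
        by (rule sum.cong) (auto simp: e_def)
      finally show ?thesis by (simp add: e_def)
    qed
    have "(\<Sum>j\<in>J. a i j * e j) = 0" using split[of i] p by simp
    moreover have "(\<Sum>j\<in>J. a k j * e j) = 0" if "k \<in> I" for k
    proof -
      have "0 = (\<Sum>j\<in>?J. a k j * d j - a k p / a i p * (a i j * d j))"
        using d(2) that by (simp add: left_diff_distrib mult.assoc)
      also have "\<dots> = (\<Sum>j\<in>?J. a k j * d j) - a k p / a i p * (\<Sum>j\<in>?J. a i j * d j)"
        by (simp add: sum_subtractf sum_distrib_left)
      finally show ?thesis using split[of k] by (simp add: field_simps)
    qed
    moreover have "\<exists>j\<in>J. e j \<noteq> 0" using d(1) by (auto simp: e_def)
    ultimately show ?thesis by (intro exI[of _ e]) auto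
  qed
qed

text \<open>The rows of a square system are tested for independence by \<open>d\<close>. If \<open>z\<close> were a nonzero
  kernel vector, the rows together with \<open>z\<close> would be too many vectors to be independent.\<close>
lemma square_system_kernel:
  fixes a :: "'i \<Rightarrow> 'j \<Rightarrow> real"
  assumes "finite I" "finite J" "card I = card J"
    and indep: "\<And>d. (\<forall>j\<in>J. (\<Sum>i\<in>I. d i * a i j) = 0) \<Longrightarrow> \<forall>i\<in>I. d i = 0"
    and z: "\<forall>i\<in>I. (\<Sum>j\<in>J. a i j * z j) = 0"
  shows "\<forall>j\<in>J. z j = 0"
proof (rule ccontr)
  assume nz: "\<not> ?thesis"
  \<comment> \<open>\<open>None\<close> labels \<open>z\<close> as one more row, which gives
    \<open>Suc (card J)\<close> vectors in a space of dimension \<open>card J\<close>.\<close>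
  let ?I = "insert None (Some ` I)"
  have fI: "finite ?I" using assms by simp
  have cI: "card ?I = Suc (card J)"
    using assms by (simp add: card_image)
  have cc: "card J < card ?I" using cI by simp
  from underdetermined_system[OF assms(2) fI cc, of "\<lambda>j i. case i of None \<Rightarrow> z j | Some i \<Rightarrow> a i j"]
  obtain d where d: "\<exists>i\<in>?I. d i \<noteq> 0"
    "\<forall>j\<in>J. (\<Sum>i\<in>?I. (case i of None \<Rightarrow> z j | Some i \<Rightarrow> a i j) * d i) = 0" by blast
  have eq: "z j * d None + (\<Sum>i\<in>I. a i j * d (Some i)) = 0" if "j \<in> J" for j
    using d(2)[rule_format, OF that] assms(1)
    by (subst (asm) sum.insert) (auto simp: sum.reindex)
  \<comment> \<open>Pair the relation with \<open>z\<close>: the old rows are orthogonal to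
    \<open>z\<close>, so only \<open>d None\<close> times the squared norm of \<open>z\<close>
    survives.\<close>
  have "0 = (\<Sum>j\<in>J. z j * (z j * d None + (\<Sum>i\<in>I. a i j * d (Some i))))"
    using eq by simp
  also have "\<dots> = d None * (\<Sum>j\<in>J. z j * z j) + (\<Sum>j\<in>J. \<Sum>i\<in>I. d (Some i) * (a i j * z j))"
    by (simp add: algebra_simps sum.distrib sum_distrib_left)
  also have "(\<Sum>j\<in>J. \<Sum>i\<in>I. d (Some i) * (a i j * z j)) = (\<Sum>i\<in>I. d (Some i) * (\<Sum>j\<in>J. a i j * z j))"
    by (subst sum.swap) (simp add: sum_distrib_left)
  also have "\<dots> = 0" using z by simp
  finally have "d None * (\<Sum>j\<in>J. z j * z j) = 0" by simp
  moreover have "(\<Sum>j\<in>J. z j * z j) \<noteq> 0"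
    using nz assms(2) by (subst sum_nonneg_eq_0_iff) auto
  ultimately have dN: "d None = 0" by simp
  have "\<forall>j\<in>J. (\<Sum>i\<in>I. d (Some i) * a i j) = 0"
    using eq dN by (simp add: mult.commute)
  from indep[OF this] have "\<forall>i\<in>I. d (Some i) = 0" .
  with dN d(1) show False by auto
qed

text \<open>A largest independent set of rows is a basis of the row space: a vector orthogonal to it that is
  not in the kernel would expose a further independent row.\<close>
lemma row_selection:
  fixes a :: "'i \<Rightarrow> 'j \<Rightarrow> real"
  assumes "finite P" "finite J"
    and ker: "\<And>z. (\<forall>i\<in>P. (\<Sum>j\<in>J. a i j * z j) = 0) \<Longrightarrow> \<forall>j\<in>J. z j = 0"
  shows "\<exists>L. L \<subseteq> P \<and> card L = card J \<and>
           (\<forall>d. (\<forall>j\<in>J. (\<Sum>i\<in>L. d i * a i j) = 0) \<longrightarrow> (\<forall>i\<in>L. d i = 0))"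
proof -
  define Q where "Q L \<longleftrightarrow> L \<subseteq> P \<and>
    (\<forall>d. (\<forall>j\<in>J. (\<Sum>i\<in>L. d i * a i j) = 0) \<longrightarrow> (\<forall>i\<in>L. d i = 0))" for L
  have bound: "card L \<le> card J" if "Q L" for L
  proof (rule ccontr)
    assume "\<not> card L \<le> card J"
    then have "card J < card L" by simp
    moreover have "finite L" using that assms(1) finite_subset by (auto simp: Q_def)
    ultimately obtain d where "\<exists>i\<in>L. d i \<noteq> 0" "\<forall>j\<in>J. (\<Sum>i\<in>L. a i j * d i) = 0"
      using underdetermined_system[OF assms(2), of L "\<lambda>j i. a i j"] by blast
    with that show False by (auto simp: Q_def mult.commute)
  qed
  have "Q {}" by (simp add: Q_def)
  then obtain L where L: "Q L" "\<And>L'. Q L' \<Longrightarrow> card L' \<le> card L"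
    using ex_has_greatest_nat[of Q "{}" card "card J + 1"] bound by force
  have fL: "finite L" using L(1) assms(1) finite_subset by (auto simp: Q_def)
  have "card L = card J"
  proof (rule ccontr)
    assume "card L \<noteq> card J"
    then have "card L < card J" using bound[OF L(1)] by simp
    from underdetermined_system[OF fL assms(2) this, of a] obtain z where
      z: "\<exists>j\<in>J. z j \<noteq> 0" "\<forall>i\<in>L. (\<Sum>j\<in>J. a i j * z j) = 0" by blast
    then obtain p where p: "p \<in> P" "(\<Sum>j\<in>J. a p j * z j) \<noteq> 0" using ker by blast
    then have pL: "p \<notin> L" using z by auto
    have "Q (insert p L)" unfolding Q_def
    proof (intro conjI allI impI)
      show "insert p L \<subseteq> P" using p L(1) by (auto simp: Q_def)
      fix d assume h: "\<forall>j\<in>J. (\<Sum>i\<in>insert p L. d i * a i j) = 0"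
      then have eq: "d p * a p j + (\<Sum>i\<in>L. d i * a i j) = 0" if "j \<in> J" for j
        using that pL fL by simp
      \<comment> \<open>Pairing with \<open>z\<close> removes the rows of \<open>L\<close> and
        isolates the coefficient of the new row.\<close>
      have "0 = (\<Sum>j\<in>J. z j * (d p * a p j + (\<Sum>i\<in>L. d i * a i j)))" using eq by simp
      also have "\<dots> = d p * (\<Sum>j\<in>J. a p j * z j) + (\<Sum>j\<in>J. \<Sum>i\<in>L. d i * (a i j * z j))"
        by (simp add: algebra_simps sum.distrib sum_distrib_left)
      also have "(\<Sum>j\<in>J. \<Sum>i\<in>L. d i * (a i j * z j)) = (\<Sum>i\<in>L. d i * (\<Sum>j\<in>J. a i j * z j))"
        by (subst sum.swap) (simp add: sum_distrib_left)
      also have "\<dots> = 0" using z by simp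
      finally have dp: "d p = 0" using p by simp
      then have "\<forall>j\<in>J. (\<Sum>i\<in>L. d i * a i j) = 0" using eq by auto
      then have "\<forall>i\<in>L. d i = 0" using L(1) by (auto simp: Q_def)
      with dp show "\<forall>i\<in>insert p L. d i = 0" by auto
    qed
    from L(2)[OF this] show False using pL fL by simp
  qed
  with L(1) show ?thesis by (auto simp: Q_def)
qed

section \<open>Orthonormal families in coherent subspaces\<close>

definition ip :: "nat \<Rightarrow> (nat \<Rightarrow> real) \<Rightarrow> (nat \<Rightarrow> real) \<Rightarrow> real" where
  "ip n f g = (\<Sum>i<n. f i * g i)"

definition subsp :: "(nat \<Rightarrow> real) set \<Rightarrow> bool" where
  "subsp W \<longleftrightarrow> (\<lambda>_. 0) \<in> W \<and> (\<forall>f\<in>W. \<forall>g\<in>W. (\<lambda>i. f i + g i) \<in> W) \<and> (\<forall>c. \<forall>f\<in>W. (\<lambda>i. c * f i) \<in> W)"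

definition orthonormal :: "(nat \<Rightarrow> real) set \<Rightarrow> nat \<Rightarrow> nat \<Rightarrow> (nat \<Rightarrow> nat \<Rightarrow> real) \<Rightarrow> bool" where
  "orthonormal W n m q \<longleftrightarrow>
     (\<forall>j<m. q j \<in> W) \<and> (\<forall>j<m. \<forall>k<m. ip n (q j) (q k) = (if j = k then 1 else 0))"

definition vanishing :: "(nat \<Rightarrow> real) set \<Rightarrow> nat set \<Rightarrow> (nat \<Rightarrow> real) set" where
  "vanishing W \<Lambda> = {f \<in> W. \<forall>i\<in>\<Lambda>. f i = 0}"

text \<open>For a subspace with bounded families, the dimension of its restriction to
  \<open>{..<n}\<close>: values at other indices are invisible to \<open>ip n\<close>.\<close>

definition odim :: "nat \<Rightarrow> (nat \<Rightarrow> real) set \<Rightarrow> nat" where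
  "odim n W = (GREATEST m. \<exists>q. orthonormal W n m q)"

lemma ip_commute: "ip n f g = ip n g f"
  by (simp add: ip_def mult.commute)

lemma ip_diff_left: "ip n (\<lambda>i. f i - g i) h = ip n f h - ip n g h"
  by (simp add: ip_def left_diff_distrib sum_subtractf)

lemma ip_scale_left: "ip n (\<lambda>i. c * f i) h = c * ip n f h"
  by (simp add: ip_def sum_distrib_left mult.assoc)

lemma ip_sum_left: "ip n (\<lambda>i. \<Sum>j\<in>J. F j i) h = (\<Sum>j\<in>J. ip n (F j) h)"
  unfolding ip_def by (simp add: sum_distrib_right) (rule sum.swap)

lemma ip_scale_right: "ip n h (\<lambda>i. c * f i) = c * ip n h f"
  using ip_scale_left[of n c f h] by (simp add: ip_commute)

lemma ip_self_nonneg: "0 \<le> ip n f f"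
  by (auto simp: ip_def intro: sum_nonneg)

lemma ip_self_pos: "i < n \<Longrightarrow> f i \<noteq> 0 \<Longrightarrow> 0 < ip n f f"
  unfolding ip_def by (rule sum_pos2[of _ i]) (auto simp: zero_less_mult_iff linorder_neq_iff)

lemma subsp_add: "subsp W \<Longrightarrow> f \<in> W \<Longrightarrow> g \<in> W \<Longrightarrow> (\<lambda>i. f i + g i) \<in> W"
  by (simp add: subsp_def)

lemma subsp_scale: "subsp W \<Longrightarrow> f \<in> W \<Longrightarrow> (\<lambda>i. c * f i) \<in> W"
  by (simp add: subsp_def)

lemma subsp_sum:
  assumes "subsp W" "\<And>j. j < (m::nat) \<Longrightarrow> q j \<in> W"
  shows "(\<lambda>i. \<Sum>j<m. c j * q j i) \<in> W"
  using assms(2)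
proof (induction m)
  case 0
  then show ?case using assms(1) by (simp add: subsp_def)
next
  case (Suc m)
  then have "(\<lambda>i. \<Sum>j<m. c j * q j i) \<in> W" "(\<lambda>i. c m * q m i) \<in> W"
    using subsp_scale[OF assms(1)] by auto
  from subsp_add[OF assms(1) this] have "(\<lambda>i. (\<Sum>j<m. c j * q j i) + c m * q m i) \<in> W" .
  then show ?case by simp
qed

lemma subsp_diff:
  assumes "subsp W" "f \<in> W" "g \<in> W"
  shows "(\<lambda>i. f i - g i) \<in> W"
  using subsp_add[OF assms(1,2) subsp_scale[OF assms(1,3), of "-1"]] by simp

lemma subsp_vanishing: "subsp W \<Longrightarrow> subsp (vanishing W \<Lambda>)"
  by (auto simp: subsp_def vanishing_def)

lemma orthonormal_mono: "W \<subseteq> W' \<Longrightarrow> orthonormal W n m q \<Longrightarrow> orthonormal W' n m q"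
  by (auto simp: orthonormal_def)

lemma ip_projection:
  assumes "orthonormal W n m q" "k < m"
  shows "ip n (\<lambda>i. \<Sum>j<m. c j * q j i) (q k) = c k"
proof -
  have "ip n (\<lambda>i. \<Sum>j<m. c j * q j i) (q k) = (\<Sum>j<m. c j * ip n (q j) (q k))"
    by (simp add: ip_sum_left ip_scale_left)
  also have "\<dots> = (\<Sum>j<m. if j = k then c j else 0)"
    using assms by (intro sum.cong) (auto simp: orthonormal_def)
  also have "\<dots> = c k" using assms by simp
  finally show ?thesis .
qed

lemma bessel:
  assumes "orthonormal W n m q"
  shows "(\<Sum>j<m. (ip n f (q j))\<^sup>2) \<le> ip n f f"
proof -
  define p where "p = (\<lambda>i. \<Sum>j<m. ip n f (q j) * q j i)"
  have pq: "ip n p (q k) = ip n f (q k)" if "k < m" for k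
    unfolding p_def using ip_projection[OF assms that] by simp
  have fp: "ip n p h = (\<Sum>j<m. ip n f (q j) * ip n (q j) h)" for h
    unfolding p_def by (simp add: ip_sum_left ip_scale_left)
  have "ip n p f = (\<Sum>j<m. (ip n f (q j))\<^sup>2)"
    unfolding fp by (simp add: ip_commute[of n _ f] power2_eq_square)
  moreover have "ip n p p = (\<Sum>j<m. (ip n f (q j))\<^sup>2)"
    unfolding fp using pq by (intro sum.cong) (auto simp: power2_eq_square ip_commute[of n _ p])
  moreover have "0 \<le> ip n (\<lambda>i. f i - p i) (\<lambda>i. f i - p i)" by (rule ip_self_nonneg)
  moreover have "ip n (\<lambda>i. f i - p i) (\<lambda>i. f i - p i) = ip n f f - 2 * ip n p f + ip n p p"
    by (simp add: ip_def algebra_simps sum.distrib sum_subtractf sum_distrib_left)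
  ultimately show ?thesis by linarith
qed

text \<open>One Gram-Schmidt step. Independence is phrased as failure of the expansion at a single
  coordinate \<open>i\<close>, because that is how it is detected later: typically all
  \<open>q j\<close> vanish at \<open>i\<close> and \<open>x\<close> does not.\<close>

lemma orthonormal_extend:
  assumes W: "subsp W" and q: "orthonormal W n m q" and x: "x \<in> W" and i: "i < n"
    and ne: "x i \<noteq> (\<Sum>j<m. ip n x (q j) * q j i)"
  shows "\<exists>q'. orthonormal W n (Suc m) q'"
proof -
  define z where "z = (\<lambda>i. x i - (\<Sum>j<m. ip n x (q j) * q j i))"
  have zW: "z \<in> W" unfolding z_def
    using q by (intro subsp_diff[OF W x] subsp_sum[OF W]) (auto simp: orthonormal_def)
  have zq: "ip n z (q k) = 0" if "k < m" for k
    unfolding z_def ip_diff_left using ip_projection[OF q that] by simp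
  have zz: "0 < ip n z z" using i ne by (intro ip_self_pos[of i]) (auto simp: z_def)
  define y where "y = (\<lambda>i. (1 / sqrt (ip n z z)) * z i)"
  have yW: "y \<in> W" unfolding y_def by (rule subsp_scale[OF W zW])
  have yy: "ip n y y = 1" unfolding y_def ip_scale_left ip_scale_right using zz by simp
  have yq: "ip n y (q k) = 0" if "k < m" for k
    unfolding y_def ip_scale_left using zq that by simp
  have "orthonormal W n (Suc m) (q(m := y))"
    using q yW yy yq yq[unfolded ip_commute[of n y]]
    by (auto simp: orthonormal_def less_Suc_eq)
  then show ?thesis by blast
qed

lemma odim_props:
  assumes "\<forall>m q. orthonormal W n m q \<longrightarrow> m \<le> b"
  shows "\<exists>q. orthonormal W n (odim n W) q" "odim n W \<le> b"
    "\<And>m q. orthonormal W n m q \<Longrightarrow> m \<le> odim n W"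
proof -
  let ?P = "\<lambda>m. \<exists>q. orthonormal W n m q"
  have 0: "?P 0" by (simp add: orthonormal_def)
  have b: "\<And>m. ?P m \<Longrightarrow> m \<le> b" using assms by blast
  show e: "?P (odim n W)" unfolding odim_def by (rule GreatestI_nat[of ?P, OF 0 b])
  show "odim n W \<le> b" using e assms by blast
  show "m \<le> odim n W" if "orthonormal W n m q" for m q
    unfolding odim_def by (rule Greatest_le_nat[of ?P, OF _ b]) (use that in blast)
qed

text \<open>A largest orthonormal family expands every \<open>z\<close> of \<open>W\<close> on
  \<open>{..<n}\<close>, since a failure would let Gram-Schmidt enlarge it. The bound
  \<open>b\<close> guarantees that a largest family exists.\<close>

lemma projection_exists:
  assumes W: "subsp W" and bnd: "\<forall>m q. orthonormal W n m q \<longrightarrow> m \<le> b"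
  shows "\<exists>y\<in>W. \<forall>z\<in>W. ip n (\<lambda>i. x i - y i) z = 0"
proof -
  obtain q where q: "orthonormal W n (odim n W) q" using odim_props(1)[OF bnd] by blast
  let ?m = "odim n W"
  define y where "y = (\<lambda>i. \<Sum>j<?m. ip n x (q j) * q j i)"
  have "y \<in> W" unfolding y_def using q by (intro subsp_sum[OF W]) (auto simp: orthonormal_def)
  moreover have "ip n (\<lambda>i. x i - y i) z = 0" if z: "z \<in> W" for z
  proof -
    have rep: "z i = (\<Sum>j<?m. ip n z (q j) * q j i)" if "i < n" for i
    proof (rule ccontr)
      assume "\<not> ?thesis"
      from orthonormal_extend[OF W q z that this] odim_props(3)[OF bnd] show False
        by fastforce
    qed
    have "ip n (\<lambda>i. x i - y i) z = ip n (\<lambda>i. \<Sum>j<?m. ip n z (q j) * q j i) (\<lambda>i. x i - y i)"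
      unfolding ip_commute[of n "\<lambda>i. x i - y i" z] unfolding ip_def
      by (intro sum.cong refl arg_cong2[where f = "(*)"] rep[unfolded ip_def]) simp
    also have "\<dots> = (\<Sum>j<?m. ip n z (q j) * ip n (\<lambda>i. x i - y i) (q j))"
      by (simp add: ip_sum_left ip_scale_left ip_commute[of n _ "\<lambda>i. x i - y i"])
    also have "\<dots> = 0"
      using ip_projection[OF q] by (intro sum.neutral) (auto simp: ip_diff_left y_def)
    finally show ?thesis .
  qed
  ultimately show ?thesis by blast
qed

section \<open>Sampling rows without replacement\<close>

text \<open>The sum in \<open>coh\<close> is the squared norm of the projection of the
  \<open>i\<close>-th unit vector onto the span of \<open>q\<close>, so \<kappa> bounds the leverage
  of every row. For the column space of \<open>A1\<close> it will be
  \<open>mu0 * r / n\<close>.\<close>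

locale coherent_subspace =
  fixes W :: "(nat \<Rightarrow> real) set" and n r :: nat and \<kappa> :: real
  assumes W: "subsp W"
    and dim: "\<forall>m q. orthonormal W n m q \<longrightarrow> m \<le> r"
    and coh: "\<And>m q i. orthonormal W n m q \<Longrightarrow> i < n \<Longrightarrow> (\<Sum>j<m. (q j i)\<^sup>2) \<le> \<kappa>"
    and \<kappa>: "0 < \<kappa>"
begin

abbreviation D :: "nat set \<Rightarrow> nat" where "D \<Lambda> \<equiv> odim n (vanishing W \<Lambda>)"

lemma dim_vanishing: "\<forall>m q. orthonormal (vanishing W \<Lambda>) n m q \<longrightarrow> m \<le> r"
proof (intro allI impI)
  fix m q assume "orthonormal (vanishing W \<Lambda>) n m q"
  then have "orthonormal W n m q" by (rule orthonormal_mono[rotated]) (auto simp: vanishing_def)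
  with dim show "m \<le> r" by blast
qed

lemmas D_props = odim_props[OF dim_vanishing]

lemma D_insert_le: "D (insert i \<Lambda>) \<le> D \<Lambda>"
proof -
  obtain q where "orthonormal (vanishing W (insert i \<Lambda>)) n (D (insert i \<Lambda>)) q"
    using D_props(1) by blast
  then have "orthonormal (vanishing W \<Lambda>) n (D (insert i \<Lambda>)) q"
    by (rule orthonormal_mono[rotated]) (auto simp: vanishing_def)
  then show ?thesis by (rule D_props(3))
qed

text \<open>A largest family vanishing on \<open>insert i \<Lambda>\<close> can be enlarged by
  \<open>x\<close>, which vanishes on \<open>\<Lambda>\<close> but not at \<open>i\<close>.\<close>

lemma D_insert_less:
  assumes "i < n" "x \<in> vanishing W \<Lambda>" "x i \<noteq> 0"
  shows "D (insert i \<Lambda>) < D \<Lambda>"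
proof -
  obtain q where q: "orthonormal (vanishing W (insert i \<Lambda>)) n (D (insert i \<Lambda>)) q"
    using D_props(1) by blast
  then have q': "orthonormal (vanishing W \<Lambda>) n (D (insert i \<Lambda>)) q"
    by (rule orthonormal_mono[rotated]) (auto simp: vanishing_def)
  have "q j i = 0" if "j < D (insert i \<Lambda>)" for j
    using q that by (auto simp: orthonormal_def vanishing_def)
  then have "x i \<noteq> (\<Sum>j<D (insert i \<Lambda>). ip n x (q j) * q j i)" using assms(3) by simp
  from orthonormal_extend[OF subsp_vanishing[OF W] q' assms(2,1) this] D_props(3)
  show ?thesis by (metis Suc_le_eq)
qed

lemma sum_D_insert:
  assumes "\<Lambda> \<subseteq> {..<n}"
  shows "(\<Sum>i\<in>{..<n} - \<Lambda>. real (D (insert i \<Lambda>))) \<le> (real (n - card \<Lambda>) - 1 / \<kappa>) * real (D \<Lambda>)"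
proof -
  define Z where "Z = {i. i < n \<and> (\<exists>x\<in>vanishing W \<Lambda>. x i \<noteq> 0)}"
  have Z: "Z \<subseteq> {..<n} - \<Lambda>" by (auto simp: Z_def vanishing_def)
  obtain q where q: "orthonormal (vanishing W \<Lambda>) n (D \<Lambda>) q" using D_props(1) by blast
  have qW: "orthonormal W n (D \<Lambda>) q"
    using q by (rule orthonormal_mono[rotated]) (auto simp: vanishing_def)
  \<comment> \<open>The trace of a projector, read once as its rank and once as the sum of its
    diagonal entries; only rows of \<open>Z\<close> contribute to the latter.\<close>
  have "real (D \<Lambda>) = (\<Sum>j<D \<Lambda>. ip n (q j) (q j))"
    using q by (simp add: orthonormal_def)
  also have "\<dots> = (\<Sum>i<n. \<Sum>j<D \<Lambda>. (q j i)\<^sup>2)"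
    unfolding ip_def by (subst sum.swap) (simp add: power2_eq_square)
  also have "\<dots> = (\<Sum>i\<in>Z. \<Sum>j<D \<Lambda>. (q j i)\<^sup>2)"
    using q by (intro sum.mono_neutral_right) (auto simp: Z_def orthonormal_def intro!: sum.neutral)
  also have "\<dots> \<le> (\<Sum>i\<in>Z. \<kappa>)"
    using coh[OF qW] by (intro sum_mono) (auto simp: Z_def)
  finally have DZ: "real (D \<Lambda>) / \<kappa> \<le> real (card Z)"
    using \<kappa> by (simp add: field_simps)
  have "real (D (insert i \<Lambda>)) \<le> real (D \<Lambda>) - (if i \<in> Z then 1 else 0)" for i
  proof (cases "i \<in> Z")
    case True
    then obtain x where "i < n" "x \<in> vanishing W \<Lambda>" "x i \<noteq> 0" by (auto simp: Z_def)
    from D_insert_less[OF this] True show ?thesis by simp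
  qed (use D_insert_le[of i \<Lambda>] in simp)
  then have "(\<Sum>i\<in>{..<n} - \<Lambda>. real (D (insert i \<Lambda>)))
      \<le> (\<Sum>i\<in>{..<n} - \<Lambda>. real (D \<Lambda>) - (if i \<in> Z then 1 else 0))"
    by (intro sum_mono) auto
  also have "\<dots> = real (n - card \<Lambda>) * real (D \<Lambda>) - card Z"
    using Z assms finite_subset[OF assms]
    by (simp add: sum_subtractf sum.If_cases card_Diff_subset Int_absorb1)
  also have "\<dots> \<le> real (n - card \<Lambda>) * real (D \<Lambda>) - real (D \<Lambda>) / \<kappa>" using DZ by simp
  finally show ?thesis by (simp add: left_diff_distrib)
qed

text \<open>This is \<open>n choose k\<close> times the mean of \<open>D\<close> over a uniform
  \<open>k\<close>-subset, left unnormalised so that double counting applies directly.\<close>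

definition total :: "nat \<Rightarrow> real" where
  "total k = (\<Sum>\<Lambda> | \<Lambda> \<subseteq> {..<n} \<and> card \<Lambda> = k. real (D \<Lambda>))"

text \<open>Count the pairs of a set of size \<open>k + 1\<close> and one of its elements in two ways.\<close>
lemma total_Suc: "real (Suc k) * total (Suc k) \<le> (real (n - k) - 1 / \<kappa>) * total k"
proof -
  let ?F = "\<lambda>k. {\<Lambda>. \<Lambda> \<subseteq> {..<n} \<and> card \<Lambda> = k}"
  have fin: "finite (?F k)" for k by (rule finite_subset[of _ "Pow {..<n}"]) auto
  have fs: "\<Lambda> \<in> ?F k \<Longrightarrow> finite \<Lambda>" for \<Lambda> k using finite_subset by blast
  have "real (Suc k) * total (Suc k) = (\<Sum>\<Lambda>\<in>?F (Suc k). \<Sum>i\<in>\<Lambda>. real (D \<Lambda>))"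
    by (simp add: total_def sum_distrib_left)
  also have "\<dots> = (\<Sum>(\<Lambda>, i)\<in>Sigma (?F (Suc k)) (\<lambda>\<Lambda>. \<Lambda>). real (D \<Lambda>))"
    by (intro sum.Sigma ballI fin) (rule fs)
  also have "\<dots> = (\<Sum>(\<Lambda>, i)\<in>Sigma (?F k) (\<lambda>\<Lambda>. {..<n} - \<Lambda>). real (D (insert i \<Lambda>)))"
  proof (rule sum.reindex_bij_witness[of _ "\<lambda>(\<Lambda>, i). (insert i \<Lambda>, i)" "\<lambda>(\<Lambda>, i). (\<Lambda> - {i}, i)"])
    fix a assume "a \<in> Sigma (?F k) (\<lambda>\<Lambda>. {..<n} - \<Lambda>)"
    then show "(case a of (\<Lambda>, i) \<Rightarrow> (insert i \<Lambda>, i)) \<in> Sigma (?F (Suc k)) (\<lambda>\<Lambda>. \<Lambda>)"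
      using fs[of "fst a" k] by (auto simp: card_insert_if)
  next
    fix a assume "a \<in> Sigma (?F (Suc k)) (\<lambda>\<Lambda>. \<Lambda>)"
    then show "(case a of (\<Lambda>, i) \<Rightarrow> (\<Lambda> - {i}, i)) \<in> Sigma (?F k) (\<lambda>\<Lambda>. {..<n} - \<Lambda>)"
      using fs[of "fst a" "Suc k"] by auto
  qed (auto simp: insert_absorb)
  also have "\<dots> = (\<Sum>\<Lambda>\<in>?F k. \<Sum>i\<in>{..<n} - \<Lambda>. real (D (insert i \<Lambda>)))"
    by (intro sum.Sigma[symmetric] ballI fin) simp
  also have "\<dots> \<le> (\<Sum>\<Lambda>\<in>?F k. (real (n - k) - 1 / \<kappa>) * real (D \<Lambda>))"
  proof (rule sum_mono)
    fix \<Lambda> assume "\<Lambda> \<in> ?F k"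
    then show "(\<Sum>i\<in>{..<n} - \<Lambda>. real (D (insert i \<Lambda>))) \<le> (real (n - k) - 1 / \<kappa>) * real (D \<Lambda>)"
      using sum_D_insert[of \<Lambda>] by simp
  qed
  finally show ?thesis by (simp add: total_def sum_distrib_left)
qed

text \<open>In terms of means, step \<open>k\<close> multiplies by at most 1 - 1 / (\<kappa> (n -
  k)). This is relaxed to 1 - 1 / (\<kappa> n), hence to an exponential independent of
  \<open>k\<close>; binomial absorption takes care of the normalisation.\<close>

lemma total_le: "k \<le> n \<Longrightarrow> total k \<le> real r * exp (- real k / (\<kappa> * real n)) * real (n choose k)"
proof (induction k)
  case 0
  have "{\<Lambda>. \<Lambda> \<subseteq> {..<n} \<and> card \<Lambda> = 0} = {{}}"
    by (auto simp: card_eq_0_iff dest: finite_subset[OF _ finite_lessThan])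
  then show ?case using D_props(2) by (simp add: total_def)
next
  case (Suc k)
  let ?e = "exp (- 1 / (\<kappa> * real n))"
  have nk: "0 < real (n - k)" "real (n - k) \<le> real n" "n > 0" using Suc.prems by auto
  have ee: "exp (- real (Suc k) / (\<kappa> * real n)) = ?e * exp (- real k / (\<kappa> * real n))"
    unfolding exp_add[symmetric] by (simp add: add_divide_distrib diff_divide_distrib)
  have T0: "0 \<le> total k" unfolding total_def by (intro sum_nonneg) simp
  have "1 + (- 1 / (\<kappa> * real n)) \<le> ?e" by (rule exp_ge_add_one_self)
  then have "real (n - k) * (1 + (- 1 / (\<kappa> * real n))) \<le> real (n - k) * ?e"
    using nk by (intro mult_left_mono) auto
  moreover have "real (n - k) - 1 / \<kappa> \<le> real (n - k) * (1 + (- 1 / (\<kappa> * real n)))"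
    using nk \<kappa> by (simp add: field_simps)
  ultimately have "(real (n - k) - 1 / \<kappa>) * total k \<le> (real (n - k) * ?e) * total k"
    using T0 by (intro mult_right_mono) auto
  also have "\<dots> \<le> (real (n - k) * ?e) * (real r * exp (- real k / (\<kappa> * real n)) * real (n choose k))"
    using Suc nk by (intro mult_left_mono) auto
  also have "\<dots> = real r * exp (- real (Suc k) / (\<kappa> * real n)) * (real (n - k) * real (n choose k))"
    unfolding ee by (simp only: mult_ac)
  also have "real (n - k) * real (n choose k) = real (Suc k) * real (n choose Suc k)"
    unfolding of_nat_mult[symmetric] by (simp only: binomial_absorb_comp binomial_absorption)
  finally have "real (Suc k) * total (Suc k)
      \<le> real (Suc k) * (real r * exp (- real (Suc k) / (\<kappa> * real n)) * real (n choose Suc k))"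
    using total_Suc[of k] by (simp only: mult_ac)
  then show ?case by (simp only: mult_le_cancel_left_pos of_nat_0_less_iff zero_less_Suc)
qed

text \<open>Markov's inequality: \<open>D\<close> is integral, hence at least 1 on every bad
  set.\<close>

lemma card_bad_le:
  assumes "w \<le> n"
  shows "real (card {\<Lambda>. \<Lambda> \<subseteq> {..<n} \<and> card \<Lambda> = w \<and> (\<exists>x\<in>vanishing W \<Lambda>. \<exists>i<n. x i \<noteq> 0)})
    \<le> real r * exp (- real w / (\<kappa> * real n)) * real (n choose w)"
proof -
  have "real (card {\<Lambda>. \<Lambda> \<subseteq> {..<n} \<and> card \<Lambda> = w \<and> (\<exists>x\<in>vanishing W \<Lambda>. \<exists>i<n. x i \<noteq> 0)})
     = (\<Sum>\<Lambda> | \<Lambda> \<subseteq> {..<n} \<and> card \<Lambda> = w \<and> (\<exists>x\<in>vanishing W \<Lambda>. \<exists>i<n. x i \<noteq> 0). 1)" by simp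
  also have "\<dots> \<le> (\<Sum>\<Lambda> | \<Lambda> \<subseteq> {..<n} \<and> card \<Lambda> = w \<and> (\<exists>x\<in>vanishing W \<Lambda>. \<exists>i<n. x i \<noteq> 0). real (D \<Lambda>))"
  proof (intro sum_mono)
    fix \<Lambda> assume "\<Lambda> \<in> {\<Lambda>. \<Lambda> \<subseteq> {..<n} \<and> card \<Lambda> = w \<and> (\<exists>x\<in>vanishing W \<Lambda>. \<exists>i<n. x i \<noteq> 0)}"
    then obtain x i where "i < n" "x \<in> vanishing W \<Lambda>" "x i \<noteq> 0" by blast
    from D_insert_less[OF this] show "1 \<le> real (D \<Lambda>)" by simp
  qed
  also have "\<dots> \<le> total w" unfolding total_def
    by (rule sum_mono2[OF finite_subset[of _ "Pow {..<n}"]]) auto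
  also note total_le[OF assms]
  finally show ?thesis .
qed

end

section \<open>Full column rank, Kruskal rank and pseudoinverses\<close>

text \<open>A kernel condition instead of a rank, because it serves to cancel the matrix on the
  left.\<close>

definition full_col_rank :: "real mat \<Rightarrow> bool" where
  "full_col_rank F \<longleftrightarrow>
     (\<forall>c \<in> carrier_vec (dim_col F). F *\<^sub>v c = 0\<^sub>v (dim_row F) \<longrightarrow> c = 0\<^sub>v (dim_col F))"

lemma full_col_rankD:
  "\<lbrakk>full_col_rank F; F \<in> carrier_mat n r; c \<in> carrier_vec r; F *\<^sub>v c = 0\<^sub>v n\<rbrakk> \<Longrightarrow> c = 0\<^sub>v r"
  unfolding full_col_rank_def by auto

lemma mat_vec_index_sum:
  "\<lbrakk>A \<in> carrier_mat n r; c \<in> carrier_vec r; i < n\<rbrakk> \<Longrightarrow> (A *\<^sub>v c) $ i = (\<Sum>l<r. A $$ (i, l) * c $ l)"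
  by (auto simp: scalar_prod_def lessThan_atLeast0 intro!: sum.cong)

lemma mrank_full_col_rank:
  assumes A: "A \<in> carrier_mat n r" and rk: "mrank A = r"
  shows "full_col_rank A"
  unfolding full_col_rank_def
proof (intro ballI impI)
  interpret vec_space "TYPE(real)" n .
  have rank: "rank A = r" using rk A by (simp add: mrank_def)
  \<comment> \<open>The rank counts a set of columns, in which repetitions are invisible. That a
    maximal independent set has \<open>r\<close> members forces the \<open>r\<close> columns to be
    distinct.\<close>
  have "distinct (cols A)"
  proof -
    obtain T where T: "maximal T (\<lambda>T. T \<subseteq> set (cols A) \<and> lin_indpt T)"
      using maximal_exists[of "\<lambda>T. T \<subseteq> set (cols A) \<and> lin_indpt T" "card (set (cols A))" "{}"]
      by (meson List.finite_set card_mono empty_iff empty_subsetI finite_lin_indpt2 finite.emptyI rev_finite_subset)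
    then have "card T = r" using rank_card_indpt[OF A] rank by simp
    moreover have "card T \<le> card (set (cols A))"
      using T by (auto simp: maximal_def intro: card_mono)
    ultimately show ?thesis
      using A card_length[of "cols A"] by (intro card_distinct) auto
  qed
  with full_rank_lin_indpt[OF A rank] lin_depI[OF A]
  show "c = 0\<^sub>v (dim_col A)" if "c \<in> carrier_vec (dim_col A)" "A *\<^sub>v c = 0\<^sub>v (dim_row A)" for c
    using that A by (metis carrier_matD)
qed

lemma full_col_rank_pair:
  assumes A: "A \<in> carrier_mat n k" "full_col_rank A" and "p < k" "q < k" "p \<noteq> q"
    and eq: "\<forall>i<n. \<alpha> * A $$ (i, p) + \<beta> * A $$ (i, q) = 0"
  shows "\<alpha> = 0 \<and> \<beta> = 0"
proof -
  define c where "c = vec k (\<lambda>j. if j = p then \<alpha> else if j = q then \<beta> else 0)"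
  have "A *\<^sub>v c = 0\<^sub>v n"
  proof (rule eq_vecI)
    fix i assume "i < dim_vec (0\<^sub>v n)"
    then have i: "i < n" by simp
    have "(A *\<^sub>v c) $ i = (\<Sum>j<k. A $$ (i, j) * c $ j)"
      using mat_vec_index_sum[OF A(1) _ i] by (simp add: c_def)
    also have "\<dots> = (\<Sum>j\<in>{p, q}. A $$ (i, j) * c $ j)"
      using assms by (intro sum.mono_neutral_right) (auto simp: c_def)
    also have "\<dots> = 0" using assms i by (auto simp: c_def algebra_simps)
    finally show "(A *\<^sub>v c) $ i = 0\<^sub>v n $ i" using i by simp
  qed (use A in simp)
  then have "c = 0\<^sub>v k" by (rule full_col_rankD[OF A(2,1), rotated]) (simp add: c_def)
  then have "c $ p = 0" "c $ q = 0" using assms by auto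
  then show ?thesis using assms by (simp add: c_def)
qed

text \<open>The Kruskal rank speaks of column sets of exactly its own size, so a pair of columns is
  first enlarged to such a set \<open>J\<close>.\<close>

lemma kruskal_rank_ge_2:
  assumes A: "A \<in> carrier_mat n r" and kr: "kruskal_rank A \<ge> 2"
  shows "r \<ge> 2"
    and "\<lbrakk>l < r; m < r; l \<noteq> m; \<forall>i<n. \<alpha> * A $$ (i, l) + \<beta> * A $$ (i, m) = 0\<rbrakk> \<Longrightarrow> \<alpha> = 0 \<and> \<beta> = 0"
proof -
  define P where "P k \<longleftrightarrow> k \<le> dim_col A \<and>
     (\<forall>J. J \<subseteq> {..<dim_col A} \<and> card J = k \<longrightarrow> mrank (submatrix A UNIV J) = k)" for k
  have K: "kruskal_rank A = (GREATEST k. P k)" by (simp add: kruskal_rank_def P_def)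
  \<comment> \<open>A witness is required for \<open>GREATEST\<close> to return a number satisfying
    \<open>P\<close>.\<close>
  have "P 0" unfolding P_def
  proof (intro conjI allI impI)
    fix J :: "nat set" assume "J \<subseteq> {..<dim_col A} \<and> card J = 0"
    then have "J = {}" using finite_subset[of J "{..<dim_col A}"] by auto
    then have "submatrix A UNIV J \<in> carrier_mat n 0"
      using A by (intro carrier_matI) (auto simp: dim_submatrix)
    from vec_space.rank_le_nc[OF this] show "mrank (submatrix A UNIV J) = 0"
      using A \<open>J = {}\<close> by (simp add: mrank_def dim_submatrix)
  qed simp
  moreover have "\<And>k. P k \<Longrightarrow> k \<le> dim_col A" by (simp add: P_def)
  ultimately have PK: "P (kruskal_rank A)" unfolding K by (rule GreatestI_nat)
  then show "r \<ge> 2" using kr A by (auto simp: P_def)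
  assume lm: "l < r" "m < r" "l \<noteq> m" and eq: "\<forall>i<n. \<alpha> * A $$ (i, l) + \<beta> * A $$ (i, m) = 0"
  let ?k = "kruskal_rank A"
  have "\<exists>J. {l, m} \<subseteq> J \<and> J \<subseteq> {..<r} \<and> card J = ?k"
    using exists_subset_between[of "{l, m}" ?k "{..<r}"] lm kr PK A by (auto simp: P_def)
  then obtain J where J: "{l, m} \<subseteq> J" "J \<subseteq> {..<r}" "card J = ?k" by blast
  let ?M = "submatrix A UNIV J"
  have Jr: "{j. j < r \<and> j \<in> J} = J" using J by auto
  have M: "?M \<in> carrier_mat n ?k" using A J Jr by (intro carrier_matI) (auto simp: dim_submatrix)
  have fcr: "full_col_rank ?M"
    using PK J A by (intro mrank_full_col_rank[OF M]) (auto simp: P_def)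
  \<comment> \<open>Column \<open>x\<close> of \<open>A\<close> moves to the position that counts
    the members of \<open>J\<close> below \<open>x\<close>.\<close>
  have ent: "?M $$ (i, card {a \<in> J. a < x}) = A $$ (i, x)" if "i < n" "x \<in> J" for i x
  proof -
    have "{a::nat. a < i} = {..<i}" by auto
    with submatrix_index_card[of i A x UNIV J] A J that show ?thesis by (auto simp: subset_iff)
  qed
  have lt: "card {a \<in> J. a < x} < ?k" if "x \<in> J" for x
    unfolding J(3)[symmetric] using that J finite_subset by (intro psubset_card_mono) auto
  have ne: "card {a \<in> J. a < l} \<noteq> card {a \<in> J. a < m}"
    using pick_card_in_set[of l J] pick_card_in_set[of m J] J lm by auto
  show "\<alpha> = 0 \<and> \<beta> = 0"
    using J eq by (intro full_col_rank_pair[OF M fcr lt lt ne]) (auto simp: ent)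
qed

section \<open>Gram matrices and Moore-Penrose inverses\<close>

lemma scalar_prod_self_eq_0:
  fixes v :: "real vec"
  assumes "v \<in> carrier_vec n" "scalar_prod v v = 0"
  shows "v = 0\<^sub>v n"
proof (rule eq_vecI)
  fix i assume "i < dim_vec (0\<^sub>v n)"
  then have i: "i < n" by simp
  have "(\<Sum>i\<in>{0..<n}. v $ i * v $ i) = 0" using assms by (simp add: scalar_prod_def)
  then have "v $ i * v $ i = 0" using i by (subst (asm) sum_nonneg_eq_0_iff) auto
  then show "v $ i = 0\<^sub>v n $ i" using i by simp
qed (use assms in simp)

text \<open>If the Gram matrix kills \<open>v\<close>, then the squared norm of
  \<open>F *\<^sub>v v\<close> is zero, so \<open>v\<close> is in the kernel of \<open>F\<close>.
  The inverse \<open>P\<close> yields the left inverse \<open>P * F\<^sup>T\<close> of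
  \<open>F\<close>.\<close>

lemma gram_inverse:
  assumes F: "F \<in> carrier_mat m r" and inj: "full_col_rank F"
  obtains P where "P \<in> carrier_mat r r" "P\<^sup>T = P" "P * (F\<^sup>T * F) = 1\<^sub>m r" "(F\<^sup>T * F) * P = 1\<^sub>m r"
proof -
  let ?G = "F\<^sup>T * F"
  have G: "?G \<in> carrier_mat r r" using F by simp
  have GT: "?G\<^sup>T = ?G" using F by (subst transpose_mult[of _ r m]) auto
  have "det ?G \<noteq> 0"
  proof
    assume "det ?G = 0"
    then obtain v where v: "v \<in> carrier_vec r" "v \<noteq> 0\<^sub>v r" "?G *\<^sub>v v = 0\<^sub>v r"
      using det_0_iff_vec_prod_zero_field[OF G] by blast
    have "scalar_prod (F *\<^sub>v v) (F *\<^sub>v v) = scalar_prod (F\<^sup>T *\<^sub>v (F *\<^sub>v v)) v"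
      using F v by (subst transpose_vec_mult_scalar[of F m r]) auto
    also have "F\<^sup>T *\<^sub>v (F *\<^sub>v v) = 0\<^sub>v r" using F v by (subst assoc_mult_mat_vec[symmetric]) auto
    finally have "scalar_prod (F *\<^sub>v v) (F *\<^sub>v v) = 0" using v by simp
    then have "F *\<^sub>v v = 0\<^sub>v m" using F v by (intro scalar_prod_self_eq_0) auto
    with full_col_rankD[OF inj F v(1)] v(2) show False by simp
  qed
  from det_non_zero_imp_unit[OF G this, unfolded Units_def, of "()"]
  obtain P where P: "P \<in> carrier_mat r r" and PG: "P * ?G = 1\<^sub>m r" and GP: "?G * P = 1\<^sub>m r"
    by (auto simp: ring_mat_def)
  have "P\<^sup>T = P\<^sup>T * (?G * P)" using P GP by simp
  also have "\<dots> = (P\<^sup>T * ?G) * P" using P G by (subst assoc_mult_mat) auto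
  also have "P\<^sup>T * ?G = (?G * P)\<^sup>T" using transpose_mult[OF G P] GT by simp
  also have "\<dots> = 1\<^sub>m r" using GP by simp
  also have "1\<^sub>m r * P = P" using P by simp
  finally show ?thesis using that P PG GP by blast
qed

definition penrose :: "real mat \<Rightarrow> real mat \<Rightarrow> bool" where
  "penrose A X \<longleftrightarrow> X \<in> carrier_mat (dim_col A) (dim_row A) \<and> A * X * A = A \<and> X * A * X = X \<and>
      (A * X)\<^sup>T = A * X \<and> (X * A)\<^sup>T = X * A"

text \<open>\<open>A * X\<close> and \<open>A * Y\<close> are both the orthogonal projection onto
  the column space of \<open>A\<close>, and \<open>X * A\<close>, \<open>Y * A\<close> both that
  onto its row space. Hence X = XAX = YAX = YAY = Y.\<close>

lemma penrose_unique:
  assumes X: "penrose A X" and Y: "penrose A Y"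
  shows "X = Y"
proof -
  define m n where "m = dim_row A" and "n = dim_col A"
  have A: "A \<in> carrier_mat m n" unfolding m_def n_def by blast
  have Xc: "X \<in> carrier_mat n m" and Yc: "Y \<in> carrier_mat n m"
    using X Y unfolding penrose_def m_def n_def by blast+
  note c = A Xc Yc
  note assoc = assoc_mult_mat[of _ m n _ m _ n] assoc_mult_mat[of _ m n _ m _ m]
    assoc_mult_mat[of _ n m _ n _ m] assoc_mult_mat[of _ n m _ n _ n]
    assoc_mult_mat[of _ m m _ n _ m] assoc_mult_mat[of _ n n _ m _ n]
    assoc_mult_mat[of _ m n _ n _ m] assoc_mult_mat[of _ n m _ m _ n]
  have pX: "A * X * A = A" "X * A * X = X" "(A * X)\<^sup>T = A * X" "(X * A)\<^sup>T = X * A"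
    and pY: "A * Y * A = A" "Y * A * Y = Y" "(A * Y)\<^sup>T = A * Y" "(Y * A)\<^sup>T = Y * A"
    using X Y unfolding penrose_def by blast+
  have "A * X = (A * Y * A) * X" by (simp only: pY)
  also have "\<dots> = (A * Y) * (A * X)" using c by (simp add: assoc)
  also have "\<dots> = (A * Y)\<^sup>T * (A * X)\<^sup>T" by (simp only: pX pY)
  also have "\<dots> = ((A * X) * (A * Y))\<^sup>T" using c by (subst transpose_mult[of _ m m]) auto
  also have "(A * X) * (A * Y) = (A * X * A) * Y" using c by (simp add: assoc)
  also have "\<dots> = A * Y" by (simp only: pX)
  also have "(A * Y)\<^sup>T = A * Y" by (simp only: pY)
  finally have 1: "A * X = A * Y" .
  have "X * A = X * (A * Y * A)" by (simp only: pY)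
  also have "\<dots> = (X * A) * (Y * A)"
    using c by (simp add: assoc)
  also have "\<dots> = (X * A)\<^sup>T * (Y * A)\<^sup>T" by (simp only: pX pY)
  also have "\<dots> = ((Y * A) * (X * A))\<^sup>T" using c by (subst transpose_mult[of _ n n]) auto
  also have "(Y * A) * (X * A) = Y * (A * X * A)"
    using c by (simp add: assoc)
  also have "\<dots> = Y * A" by (simp only: pX)
  also have "(Y * A)\<^sup>T = Y * A" by (simp only: pY)
  finally have 2: "X * A = Y * A" .
  have "X = X * A * X" by (simp only: pX)
  also have "\<dots> = Y * A * X" by (simp only: 2)
  also have "\<dots> = Y * (A * X)" using c by (simp add: assoc)
  also have "\<dots> = Y * A * Y" using 1 c by (simp add: assoc)
  also have "\<dots> = Y" by (simp only: pY)
  finally show ?thesis .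
qed

lemma penrose_pinv:
  assumes "penrose A X"
  shows "penrose A (pinv A)"
proof -
  have "pinv A = (THE X. penrose A X)" by (simp add: pinv_def penrose_def)
  also have "\<dots> = X" using assms penrose_unique by blast
  finally show ?thesis using assms by simp
qed

text \<open>The inverse is \<open>R * L\<close> for the Gram left inverse \<open>L\<close> of
  \<open>F\<close> and the Gram right inverse \<open>R\<close> of \<open>G\<close>. The two mixed
  products collapse to \<open>F * L\<close> and \<open>R * G\<close>, which are symmetric.\<close>

lemma penrose_pinv_mult:
  assumes F: "F \<in> carrier_mat m r" "full_col_rank F"
    and G: "G \<in> carrier_mat r n" "full_col_rank (G\<^sup>T)"
  shows "penrose (F * G) (pinv (F * G))"
proof -
  obtain P where P: "P \<in> carrier_mat r r" "P\<^sup>T = P" "P * (F\<^sup>T * F) = 1\<^sub>m r"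
    by (rule gram_inverse[OF F])
  have GT: "G\<^sup>T \<in> carrier_mat n r" using G by simp
  obtain Q where Q: "Q \<in> carrier_mat r r" "Q\<^sup>T = Q" "(G * G\<^sup>T) * Q = 1\<^sub>m r"
    by (rule gram_inverse[OF GT G(2)]) simp
  define L where "L = P * F\<^sup>T"
  define R where "R = G\<^sup>T * Q"
  have L: "L \<in> carrier_mat r m" and R: "R \<in> carrier_mat n r"
    using P Q F G by (auto simp: L_def R_def)
  have LF: "L * F = 1\<^sub>m r" unfolding L_def using P F by (subst assoc_mult_mat) auto
  have GR: "G * R = 1\<^sub>m r" unfolding R_def using Q G by (subst assoc_mult_mat[symmetric]) auto
  have LT: "(F * L)\<^sup>T = F * L"
  proof -
    have "(F * L)\<^sup>T = (P * F\<^sup>T)\<^sup>T * F\<^sup>T"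
      unfolding L_def using F P(1) by (intro transpose_mult) auto
    also have "(P * F\<^sup>T)\<^sup>T = F * P" using F P(1,2) by (subst transpose_mult) auto
    finally show ?thesis unfolding L_def using F P(1) by (simp add: assoc_mult_mat[of _ m r _ r])
  qed
  have RT: "(R * G)\<^sup>T = R * G"
  proof -
    have "(R * G)\<^sup>T = G\<^sup>T * (G\<^sup>T * Q)\<^sup>T"
      unfolding R_def using G Q(1) by (intro transpose_mult) auto
    also have "(G\<^sup>T * Q)\<^sup>T = Q * G" using G Q(1,2) by (subst transpose_mult) auto
    finally show ?thesis unfolding R_def using G Q(1) by (simp add: assoc_mult_mat[of _ n r _ r])
  qed
  have AX: "F * G * (R * L) = F * L"
  proof -
    have "F * G * (R * L) = F * ((G * R) * L)"
      using F G R L by (simp add: assoc_mult_mat[of _ m r _ n _ m] assoc_mult_mat[of _ r n _ r _ m])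
    then show ?thesis using L GR by simp
  qed
  have XA: "(R * L) * (F * G) = R * G"
  proof -
    have "(R * L) * (F * G) = R * ((L * F) * G)"
      using F G R L by (simp add: assoc_mult_mat[of _ n r _ m _ n] assoc_mult_mat[of _ r m _ r _ n])
    then show ?thesis using G LF by simp
  qed
  have "penrose (F * G) (R * L)"
    unfolding penrose_def AX XA
  proof (intro conjI)
    show "R * L \<in> carrier_mat (dim_col (F * G)) (dim_row (F * G))" using F G R L by simp
    have "F * L * (F * G) = F * ((L * F) * G)"
      using F G L by (simp add: assoc_mult_mat[of _ m r _ m _ n] assoc_mult_mat[of _ r m _ r _ n])
    then show "F * L * (F * G) = F * G" using LF G by simp
    have "R * G * (R * L) = R * ((G * R) * L)"
      using R G L by (simp add: assoc_mult_mat[of _ n r _ n _ m] assoc_mult_mat[of _ r n _ r _ m])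
    then show "R * G * (R * L) = R * L" using GR L by simp
  qed (simp_all only: LT RT)
  then show ?thesis by (rule penrose_pinv)
qed

section \<open>Coherence of a column space\<close>

text \<open>Functions with only the first \<open>dim_row A\<close> values constrained, so that a
  tensor fibre such as \<open>\<lambda>a. T a p k\<close> can be a member although the tensor is
  arbitrary outside its index range.\<close>

definition colspace :: "real mat \<Rightarrow> (nat \<Rightarrow> real) set" where
  "colspace A = {f. \<exists>c \<in> carrier_vec (dim_col A). \<forall>i < dim_row A. f i = (A *\<^sub>v c) $ i}"

definition lin_indep :: "nat \<Rightarrow> nat \<Rightarrow> (nat \<Rightarrow> nat \<Rightarrow> real) \<Rightarrow> bool" where
  "lin_indep n k q \<longleftrightarrow> (\<forall>d. (\<forall>i<n. (\<Sum>j<k. d j * q j i) = 0) \<longrightarrow> (\<forall>j<k. d j = 0))"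

lemma colspaceI:
  "\<lbrakk>A \<in> carrier_mat n r; c \<in> carrier_vec r; \<And>i. i < n \<Longrightarrow> f i = (A *\<^sub>v c) $ i\<rbrakk> \<Longrightarrow> f \<in> colspace A"
  by (auto simp: colspace_def)

lemma colspaceE:
  assumes "f \<in> colspace A" "A \<in> carrier_mat n r"
  obtains c where "c \<in> carrier_vec r" "\<forall>i<n. f i = (A *\<^sub>v c) $ i"
  using assms by (auto simp: colspace_def)

lemma subsp_colspace: "subsp (colspace A)"
proof -
  define n r where "n = dim_row A" and "r = dim_col A"
  have A: "A \<in> carrier_mat n r" unfolding n_def r_def by blast
  show ?thesis unfolding subsp_def
  proof (intro conjI ballI allI)
    show "(\<lambda>_. 0) \<in> colspace A"
      using A by (intro colspaceI[OF A, of "0\<^sub>v r"]) auto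
  next
    fix f g assume f: "f \<in> colspace A" and g: "g \<in> colspace A"
    obtain c where c: "c \<in> carrier_vec r" "\<forall>i<n. f i = (A *\<^sub>v c) $ i"
      by (rule colspaceE[OF f A])
    obtain d where d: "d \<in> carrier_vec r" "\<forall>i<n. g i = (A *\<^sub>v d) $ i"
      by (rule colspaceE[OF g A])
    show "(\<lambda>i. f i + g i) \<in> colspace A"
      using A c d by (intro colspaceI[OF A, of "c + d"]) (auto simp: mult_add_distrib_mat_vec[OF A])
  next
    fix a f assume f: "f \<in> colspace A"
    obtain c where c: "c \<in> carrier_vec r" "\<forall>i<n. f i = (A *\<^sub>v c) $ i"
      by (rule colspaceE[OF f A])
    show "(\<lambda>i. a * f i) \<in> colspace A"
      using A c by (intro colspaceI[OF A, of "a \<cdot>\<^sub>v c"]) (auto simp: mult_mat_vec[OF A])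
  qed
qed

text \<open>More than \<open>r\<close> coefficient vectors of length \<open>r\<close> satisfy a
  nontrivial relation, and \<open>A\<close> carries it over to the functions.\<close>

lemma lin_indep_colspace_le:
  assumes A: "A \<in> carrier_mat n r" and q: "\<forall>j<k. q j \<in> colspace A" and ind: "lin_indep n k q"
  shows "k \<le> r"
proof (rule ccontr)
  assume "\<not> k \<le> r"
  have "\<forall>j<k. \<exists>c. c \<in> carrier_vec r \<and> (\<forall>i<n. q j i = (A *\<^sub>v c) $ i)"
    using q A unfolding colspace_def by auto
  then obtain c where c: "\<And>j. j < k \<Longrightarrow> c j \<in> carrier_vec r"
    "\<And>j i. j < k \<Longrightarrow> i < n \<Longrightarrow> q j i = (A *\<^sub>v c j) $ i" by metis
  have "card {..<r} < card {..<k}" using \<open>\<not> k \<le> r\<close> by simp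
  from underdetermined_system[OF _ _ this, of "\<lambda>l j. c j $ l"] obtain d where
    d: "\<exists>j<k. d j \<noteq> 0" "\<And>l. l < r \<Longrightarrow> (\<Sum>j<k. c j $ l * d j) = 0" by auto
  have "(\<Sum>j<k. d j * q j i) = 0" if i: "i < n" for i
  proof -
    have "(\<Sum>j<k. d j * q j i) = (\<Sum>j<k. \<Sum>l<r. A $$ (i, l) * (c j $ l * d j))"
    proof (rule sum.cong[OF refl])
      fix j assume "j \<in> {..<k}"
      then have "q j i = (\<Sum>l<r. A $$ (i, l) * c j $ l)"
        using c i mat_vec_index_sum[OF A] by simp
      then show "d j * q j i = (\<Sum>l<r. A $$ (i, l) * (c j $ l * d j))"
        by (simp add: sum_distrib_left mult_ac)
    qed
    also have "\<dots> = (\<Sum>l<r. A $$ (i, l) * (\<Sum>j<k. c j $ l * d j))"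
      by (subst sum.swap) (simp add: sum_distrib_left)
    also have "\<dots> = 0" using d(2) by simp
    finally show ?thesis .
  qed
  with ind d(1) show False unfolding lin_indep_def by blast
qed

lemma orthonormal_lin_indep:
  assumes q: "orthonormal W n m q"
  shows "lin_indep n m q"
  unfolding lin_indep_def
proof (intro allI impI)
  fix d k assume d: "\<forall>i<n. (\<Sum>j<m. d j * q j i) = 0" and k: "k < m"
  have "d k = ip n (\<lambda>i. \<Sum>j<m. d j * q j i) (q k)" using ip_projection[OF q k] by simp
  also have "\<dots> = 0" using d by (simp add: ip_def)
  finally show "d k = 0" .
qed

lemma orthonormal_colspace_le:
  "A \<in> carrier_mat n r \<Longrightarrow> orthonormal (colspace A) n m q \<Longrightarrow> m \<le> r"
  by (rule lin_indep_colspace_le[OF _ _ orthonormal_lin_indep]) (auto simp: orthonormal_def)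

text \<open>This gives the \<open>THE\<close> in \<open>proj_col\<close> a meaning. For uniqueness,
  the difference of two candidates lies in the column space and is a difference of two residuals, so
  it is orthogonal to itself.\<close>

lemma proj_col_unit_vec:
  assumes A: "A \<in> carrier_mat n r" and i: "i < n"
  shows "proj_col A (unit_vec n i) \<in> col_sp A"
    and "z \<in> col_sp A \<Longrightarrow> scalar_prod (unit_vec n i - proj_col A (unit_vec n i)) z = 0"
proof -
  let ?e = "unit_vec n i"
  let ?Q = "\<lambda>y. y \<in> col_sp A \<and> (\<forall>z\<in>col_sp A. scalar_prod (?e - y) z = 0)"
  have sp: "z \<in> carrier_vec n" if "z \<in> col_sp A" for z using A that by (auto simp: col_sp_def)
  have spc: "A *\<^sub>v d \<in> col_sp A" if "d \<in> carrier_vec r" for d using A that by (auto simp: col_sp_def)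
  have sip: "scalar_prod (u - v) z = ip n (\<lambda>i. u $ i - v $ i) (($) z)"
    if "u \<in> carrier_vec n" "v \<in> carrier_vec n" "z \<in> carrier_vec n" for u v z :: "real vec"
    using that by (simp add: scalar_prod_def ip_def lessThan_atLeast0)
  have "\<forall>m q. orthonormal (colspace A) n m q \<longrightarrow> m \<le> r" using orthonormal_colspace_le[OF A] by blast
  from projection_exists[OF subsp_colspace this, of "($) ?e"]
  obtain f where f: "f \<in> colspace A" "\<And>g. g \<in> colspace A \<Longrightarrow> ip n (\<lambda>k. ?e $ k - f k) g = 0"
    by blast
  obtain c where c: "c \<in> carrier_vec r" "\<forall>i<n. f i = (A *\<^sub>v c) $ i"
    by (rule colspaceE[OF f(1) A])
  define p where "p = A *\<^sub>v c"
  have pn: "p \<in> carrier_vec n" and psp: "p \<in> col_sp A" using A c spc by (auto simp: p_def)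
  have ort: "scalar_prod (?e - p) z = 0" if z: "z \<in> col_sp A" for z
  proof -
    have "($) z \<in> colspace A" using A z by (auto simp: col_sp_def colspace_def)
    then have "ip n (\<lambda>k. ?e $ k - f k) (($) z) = 0" by (rule f(2))
    moreover have "ip n (\<lambda>k. ?e $ k - f k) (($) z) = ip n (\<lambda>k. ?e $ k - p $ k) (($) z)"
      using c(2) by (simp add: ip_def p_def)
    ultimately show ?thesis using sip[OF _ pn sp[OF z], of ?e] by simp
  qed
  have un: "y = p" if y: "?Q y" for y
  proof -
    obtain d where d: "d \<in> carrier_vec r" "y = A *\<^sub>v d" using y A by (auto simp: col_sp_def)
    have "A *\<^sub>v (d - c) \<in> col_sp A" using c d by (intro spc) simp
    then have z: "y - p \<in> col_sp A"
      unfolding mult_minus_distrib_mat_vec[OF A d(1) c(1)] d(2) p_def .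
    have yn: "y \<in> carrier_vec n" using A d by simp
    have "scalar_prod (y - p) (y - p) = scalar_prod (?e - p) (y - p) - scalar_prod (?e - y) (y - p)"
      using pn yn by (simp add: scalar_prod_def algebra_simps sum_subtractf sum.distrib sum_distrib_left)
    also have "\<dots> = 0" using z y ort by simp
    finally have "y - p = 0\<^sub>v n" using pn yn by (intro scalar_prod_self_eq_0) auto
    then have "(y - p) $ k = 0" if "k < n" for k using that by simp
    then show ?thesis using pn yn by (intro eq_vecI) auto
  qed
  have "?Q (proj_col A ?e)" unfolding proj_col_def
  proof (rule theI[of ?Q])
    show "?Q p" using psp ort by blast
  qed (rule un)
  then show "proj_col A ?e \<in> col_sp A"
    "z \<in> col_sp A \<Longrightarrow> scalar_prod (?e - proj_col A ?e) z = 0" by auto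
qed

text \<open>For \<open>q j\<close> in the column space, its entry at \<open>i\<close> is its inner
  product with the unit vector and therefore with the projection \<open>y\<close>. Bessel bounds the
  sum of squares by the squared norm of \<open>y\<close>, which coherence controls.\<close>

lemma coherent_subspace_colspace:
  assumes A: "A \<in> carrier_mat n r" and pos: "0 < n" "0 < r" "0 < mu0" and coh: "coherence A \<le> mu0"
  shows "coherent_subspace (colspace A) n r (mu0 * real r / real n)"
proof
  show "subsp (colspace A)" by (rule subsp_colspace)
  show "\<forall>m q. orthonormal (colspace A) n m q \<longrightarrow> m \<le> r" using orthonormal_colspace_le[OF A] by blast
  show "0 < mu0 * real r / real n" using pos by simp
  fix m q i assume q: "orthonormal (colspace A) n m q" and i: "i < n"
  define y where "y = proj_col A (unit_vec n i)"
  note y = proj_col_unit_vec[OF A i, folded y_def]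
  obtain c where c: "c \<in> carrier_vec r" "y = A *\<^sub>v c" using y(1) A by (auto simp: col_sp_def)
  have yc: "y \<in> carrier_vec n" using A c by simp
  have qy: "q j i = ip n (($) y) (q j)" if j: "j < m" for j
  proof -
    have qj: "q j \<in> colspace A" using q j by (simp add: orthonormal_def)
    obtain d where d: "d \<in> carrier_vec r" "\<forall>i<n. q j i = (A *\<^sub>v d) $ i"
      by (rule colspaceE[OF qj A])
    have "A *\<^sub>v d \<in> col_sp A" using d(1) A by (auto simp: col_sp_def)
    from y(2)[OF this] have "(\<Sum>k<n. (unit_vec n i $ k - y $ k) * (A *\<^sub>v d) $ k) = 0"
      using A yc by (simp add: scalar_prod_def lessThan_atLeast0)
    then have "(\<Sum>k<n. (unit_vec n i $ k - y $ k) * q j k) = 0"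
      by (simp add: d(2) cong: sum.cong_simp)
    moreover have "(\<Sum>k<n. unit_vec n i $ k * q j k) = (\<Sum>k<n. if k = i then q j k else 0)"
      using i by (intro sum.cong) auto
    ultimately show ?thesis using i by (simp add: ip_def left_diff_distrib sum_subtractf)
  qed
  have "(\<Sum>j<m. (q j i)\<^sup>2) = (\<Sum>j<m. (ip n (($) y) (q j))\<^sup>2)"
    by (intro sum.cong refl arg_cong[where f = "\<lambda>x. x\<^sup>2"] qy) simp
  also have "\<dots> \<le> ip n (($) y) (($) y)" by (rule bessel[OF q])
  also have "\<dots> = scalar_prod y y" using yc by (simp add: ip_def scalar_prod_def lessThan_atLeast0)
  also have "\<dots> \<le> Max {scalar_prod (proj_col A (unit_vec (dim_row A) i)) (proj_col A (unit_vec (dim_row A) i)) | i. i < dim_row A}"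
    using A i by (intro Max_ge) (auto simp: y_def)
  also have "\<dots> \<le> mu0 * real r / real n"
    using coh pos A by (simp add: coherence_def field_simps)
  finally show "(\<Sum>j<m. (q j i)\<^sup>2) \<le> mu0 * real r / real n" .
qed

section \<open>Exactness of adaptive matrix completion\<close>

definition determining :: "real mat \<Rightarrow> nat set \<Rightarrow> bool" where
  "determining A \<Lambda> \<longleftrightarrow> (\<forall>f\<in>colspace A. (\<forall>i\<in>\<Lambda>. f i = 0) \<longrightarrow> (\<forall>i<dim_row A. f i = 0))"

text \<open>\<open>k\<close> is both the number of stored columns and the index of the current draw,
  since redrawing and appending happen together. Independence thus bounds the draw index as well as
  the number of fully observed columns.\<close>

definition amc_inv :: "real mat \<Rightarrow> (nat \<Rightarrow> nat \<Rightarrow> real) \<Rightarrow> nat \<Rightarrow> nat \<Rightarrow>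
    real vec list \<times> nat \<times> real vec list \<times> (nat \<times> nat) set \<Rightarrow> bool" where
  "amc_inv A M w i st = (case st of (Bs, k, cs, obs) \<Rightarrow>
     k = length Bs \<and> (\<forall>j<k. ($) (Bs ! j) \<in> colspace A) \<and> lin_indep (dim_row A) k (\<lambda>j. ($) (Bs ! j)) \<and>
     length cs = i \<and> (\<forall>p<i. \<forall>a<dim_row A. (cs ! p) $ a = M a p) \<and>
     finite obs \<and> card obs \<le> i * w + k * dim_row A)"

text \<open>Restriction to a determining set is injective on the column space, so the membership
  test on sampled rows gives the same answer as on full columns: a positive test reconstructs the
  column exactly, a negative one certifies independence.\<close>

lemma amc_step_inv:
  assumes A: "A \<in> carrier_mat n r" and M: "(\<lambda>a. M a p) \<in> colspace A"
    and Lams: "\<forall>k\<le>r. determining A (Lams k) \<and> Lams k \<subseteq> {..<n} \<and> card (Lams k) = w"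
    and inv: "amc_inv A M w p st"
  shows "amc_inv A M w (Suc p) (amc_step n M Lams st p)"
proof -
  obtain Bs k cs obs where st: "st = (Bs, k, cs, obs)" by (cases st)
  have dr: "dim_row A = n" using A by simp
  have k: "k = length Bs" and Bs: "\<And>j. j < k \<Longrightarrow> ($) (Bs ! j) \<in> colspace A"
    and ind: "lin_indep n k (\<lambda>j. ($) (Bs ! j))"
    and cs: "length cs = p" "\<And>q a. q < p \<Longrightarrow> a < n \<Longrightarrow> (cs ! q) $ a = M a q"
    and obs: "finite obs" "card obs \<le> p * w + k * n"
    using inv unfolding amc_inv_def st prod.case dr by blast+
  \<comment> \<open>Equality is possible: once \<open>r\<close> columns are stored, draw number
    \<open>r\<close> still tests the remaining ones, so the draws 0 to \<open>r\<close> all have to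
    be good.\<close>
  have "k \<le> r" using lin_indep_colspace_le[OF A _ ind] Bs by blast
  define Lam where "Lam = Lams k"
  have Lam: "determining A Lam" "Lam \<subseteq> {..<n}" "card Lam = w"
    using Lams \<open>k \<le> r\<close> unfolding Lam_def by blast+
  have fL: "finite Lam" using Lam(2) finite_subset by blast
  define idx where "idx = sorted_list_of_set Lam"
  define m where "m = length idx"
  have idx: "set idx = Lam" using fL by (simp add: idx_def)
  define BL where "BL = mat m (length Bs) (\<lambda>(a, j). (Bs ! j) $ (idx ! a))"
  define yL where "yL = vec m (\<lambda>a. M (idx ! a) p)"
  have BL: "BL \<in> carrier_mat m k" by (simp add: BL_def k)
  have yLc: "yL \<in> carrier_vec m" by (simp add: yL_def)
  have BLi: "(BL *\<^sub>v c) $ a = (\<Sum>j<k. c $ j * (Bs ! j) $ (idx ! a))"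
    if "c \<in> carrier_vec k" "a < m" for c a
    unfolding mat_vec_index_sum[OF BL that]
    by (rule sum.cong[OF refl]) (use that in \<open>simp add: BL_def k\<close>)
  have ext: "\<forall>i<n. f i = 0" if "f \<in> colspace A" "\<And>a. a < m \<Longrightarrow> f (idx ! a) = 0" for f
  proof -
    have "\<forall>i\<in>Lam. f i = 0" using that(2) idx by (metis in_set_conv_nth m_def)
    then show ?thesis using Lam(1) that(1) unfolding determining_def dr by blast
  qed
  have comb: "(\<lambda>i. \<Sum>j<k. d j * (Bs ! j) $ i) \<in> colspace A" for d
    by (rule subsp_sum[OF subsp_colspace]) (rule Bs)
  have e: "{(a, p) | a. a \<in> Lam} = (\<lambda>a. (a, p)) ` Lam" "{(a, p) | a. a < n} = (\<lambda>a. (a, p)) ` {..<n}" by auto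
  have cL: "finite {(a, p) | a. a \<in> Lam}" "card {(a, p) | a. a \<in> Lam} \<le> w"
    "finite {(a, p) | a. a < n}" "card {(a, p) | a. a < n} \<le> n"
    unfolding e using fL card_image_le[OF fL, of "\<lambda>a. (a, p)"] Lam(3)
      card_image_le[of "{..<n}" "\<lambda>a. (a, p)"] by simp_all
  define obs' where "obs' = obs \<union> {(a, p) | a. a \<in> Lam}"
  have obs': "finite obs'" "card obs' \<le> Suc p * w + k * n"
    unfolding obs'_def using cL(1,2) obs card_Un_le[of obs "{(a, p) | a. a \<in> Lam}"] by auto
  have step: "amc_step n M Lams st p =
     (if yL \<in> col_sp BL
        then (Bs, k, cs @ [mat_of_cols n Bs *\<^sub>v (pinv BL *\<^sub>v yL)], obs')
        else (Bs @ [vec n (\<lambda>a. M a p)], Suc k, cs @ [vec n (\<lambda>a. M a p)], obs' \<union> {(a, p) | a. a < n}))"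
    unfolding amc_step_def st prod.case Let_def obs'_def yL_def BL_def m_def idx_def Lam_def by (rule refl)
  show ?thesis
  proof (cases "yL \<in> col_sp BL")
    case True
    then obtain c where c: "c \<in> carrier_vec k" "yL = BL *\<^sub>v c" using BL by (auto simp: col_sp_def)
    \<comment> \<open>A combination of stored columns that vanishes on \<open>Lam\<close> vanishes
      on every row, so independence survives the restriction.\<close>
    have "full_col_rank BL" unfolding full_col_rank_def
    proof (intro ballI impI)
      fix d assume d: "d \<in> carrier_vec (dim_col BL)" "BL *\<^sub>v d = 0\<^sub>v (dim_row BL)"
      then have dk: "d \<in> carrier_vec k" using BL by simp
      have "(\<Sum>j<k. d $ j * (Bs ! j) $ (idx ! a)) = 0" if "a < m" for a
        using BLi[OF dk that] d BL that by simp
      from ext[OF comb this] have "\<forall>j<k. d $ j = 0" using ind unfolding lin_indep_def by blast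
      then show "d = 0\<^sub>v (dim_col BL)" using d BL by (intro eq_vecI) auto
    qed
    \<comment> \<open>The trivial factorization brings \<open>BL\<close> into the form for which a
      Moore-Penrose inverse was constructed.\<close>
    then have "penrose (BL * 1\<^sub>m k) (pinv (BL * 1\<^sub>m k))"
      using BL by (intro penrose_pinv_mult[of BL m k "1\<^sub>m k" k]) (auto simp: full_col_rank_def)
    then have pen: "pinv BL \<in> carrier_mat k m" "BL * pinv BL * BL = BL"
      unfolding right_mult_one_mat[OF BL] using BL unfolding penrose_def by auto
    define e where "e = pinv BL *\<^sub>v yL"
    have ek: "e \<in> carrier_vec k" using pen(1) yLc by (simp add: e_def)
    have "BL *\<^sub>v e = (BL * pinv BL) *\<^sub>v yL"
      unfolding e_def using assoc_mult_mat_vec[OF BL pen(1) yLc] by simp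
    also have "\<dots> = (BL * pinv BL * BL) *\<^sub>v c"
      unfolding c(2) using BL pen(1) c(1) by (intro assoc_mult_mat_vec[symmetric]) auto
    also have "\<dots> = yL" unfolding pen(2) c(2) ..
    finally have BLe: "BL *\<^sub>v e = yL" .
    have "(\<lambda>i. (\<Sum>j<k. e $ j * (Bs ! j) $ i) - M i p) \<in> colspace A"
      by (rule subsp_diff[OF subsp_colspace comb M])
    moreover have "(\<Sum>j<k. e $ j * (Bs ! j) $ (idx ! a)) - M (idx ! a) p = 0" if "a < m" for a
      using BLi[OF ek that] that unfolding BLe by (simp add: yL_def)
    ultimately have zero: "\<forall>i<n. (\<Sum>j<k. e $ j * (Bs ! j) $ i) - M i p = 0" by (rule ext)
    have new: "(mat_of_cols n Bs *\<^sub>v e) $ i = M i p" if i: "i < n" for i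
    proof -
      have "mat_of_cols n Bs \<in> carrier_mat n k" by (simp add: k)
      from mat_vec_index_sum[OF this ek i]
      have "(mat_of_cols n Bs *\<^sub>v e) $ i = (\<Sum>j<k. mat_of_cols n Bs $$ (i, j) * e $ j)" .
      also have "\<dots> = (\<Sum>j<k. e $ j * (Bs ! j) $ i)"
        by (rule sum.cong[OF refl]) (use i in \<open>simp add: k mat_of_cols_index\<close>)
      finally show ?thesis using zero i by simp
    qed
    have "amc_step n M Lams st p = (Bs, k, cs @ [mat_of_cols n Bs *\<^sub>v e], obs')"
      unfolding step e_def using True by simp
    moreover have "\<forall>q<Suc p. \<forall>a<n. (cs @ [mat_of_cols n Bs *\<^sub>v e]) ! q $ a = M a q"
      using cs new by (simp add: less_Suc_eq nth_append all_conj_distrib)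
    ultimately show ?thesis
      using k Bs ind cs(1) obs' by (simp add: amc_inv_def dr)
  next
    case False
    define c where "c = vec n (\<lambda>a. M a p)"
    have cA: "($) c \<in> colspace A"
    proof -
      obtain d where "d \<in> carrier_vec r" "\<forall>i<n. M i p = (A *\<^sub>v d) $ i"
        by (rule colspaceE[OF M A])
      then show ?thesis by (intro colspaceI[OF A, of d]) (auto simp: c_def)
    qed
    have ind': "lin_indep n (Suc k) (\<lambda>j. ($) ((Bs @ [c]) ! j))" unfolding lin_indep_def
    proof (intro allI impI)
      fix d j assume d: "\<forall>i<n. (\<Sum>j<Suc k. d j * (Bs @ [c]) ! j $ i) = 0" and j: "j < Suc k"
      have eq: "(\<Sum>j<k. d j * Bs ! j $ i) + d k * M i p = 0" if "i < n" for i
      proof -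
        have "(\<Sum>j<k. d j * (Bs @ [c]) ! j $ i) = (\<Sum>j<k. d j * Bs ! j $ i)"
          by (rule sum.cong) (auto simp: nth_append k)
        then show ?thesis using d[rule_format, OF that] that by (simp add: nth_append k c_def)
      qed
      \<comment> \<open>Otherwise the relation could be solved for column \<open>p\<close>, and its
        restriction to the sampled rows would make the test positive.\<close>
      have dk: "d k = 0"
      proof (rule ccontr)
        assume nz: "d k \<noteq> 0"
        define e where "e = vec k (\<lambda>j. - d j / d k)"
        have ek: "e \<in> carrier_vec k" by (simp add: e_def)
        have "BL *\<^sub>v e = yL"
        proof (rule eq_vecI)
          fix a assume "a < dim_vec yL"
          then have a: "a < m" by (simp add: yL_def)
          then have an: "idx ! a < n" using Lam(2) idx nth_mem[of a idx] by (auto simp: m_def)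
          have "(BL *\<^sub>v e) $ a = (\<Sum>j<k. - (d j * Bs ! j $ (idx ! a)) / d k)"
            unfolding BLi[OF ek a] by (rule sum.cong[OF refl]) (simp add: e_def)
          also have "\<dots> = - (\<Sum>j<k. d j * Bs ! j $ (idx ! a)) / d k"
            by (simp add: sum_negf sum_divide_distrib)
          also have "\<dots> = M (idx ! a) p" using eq[OF an] nz by (simp add: field_simps)
          finally show "(BL *\<^sub>v e) $ a = yL $ a" using a by (simp add: yL_def)
        qed (use BL in \<open>simp add: yL_def\<close>)
        then have "yL \<in> col_sp BL" using BL ek by (auto simp: col_sp_def)
        with False show False by simp
      qed
      then have "\<forall>i<n. (\<Sum>j<k. d j * Bs ! j $ i) = 0" using eq by auto
      then have "\<forall>j<k. d j = 0" using ind unfolding lin_indep_def by blast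
      with dk j show "d j = 0" by (auto simp: less_Suc_eq)
    qed
    have card': "card (obs' \<union> {(a, p) | a. a < n}) \<le> Suc p * w + Suc k * n"
      using obs' cL(4) card_Un_le[of obs' "{(a, p) | a. a < n}"] by simp
    have st': "amc_step n M Lams st p = (Bs @ [c], Suc k, cs @ [c], obs' \<union> {(a, p) | a. a < n})"
      unfolding step c_def using False by simp
    have Bs': "\<forall>j<Suc k. ($) ((Bs @ [c]) ! j) \<in> colspace A"
      using Bs cA by (simp add: less_Suc_eq nth_append k all_conj_distrib)
    have cs': "\<forall>q<Suc p. \<forall>a<n. (cs @ [c]) ! q $ a = M a q"
      using cs by (simp add: less_Suc_eq nth_append c_def all_conj_distrib)
    have fin': "finite (obs' \<union> {(a, p) | a. a < n})" using obs'(1) cL(3) by blast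
    show ?thesis
      unfolding amc_inv_def st' prod.case dr
      using k ind' card' Bs' cs' fin' cs(1) by simp
  qed
qed

lemma amc_exact:
  assumes A: "A \<in> carrier_mat n1 r" and M: "\<And>p. p < n2 \<Longrightarrow> (\<lambda>a. M a p) \<in> colspace A"
    and Lams: "\<forall>k\<le>r. determining A (Lams k) \<and> Lams k \<subseteq> {..<n1} \<and> card (Lams k) = w"
  shows "\<And>a i. a < n1 \<Longrightarrow> i < n2 \<Longrightarrow> fst (amc n1 n2 M Lams) $$ (a, i) = M a i"
    and "finite (snd (amc n1 n2 M Lams))"
    and "card (snd (amc n1 n2 M Lams)) \<le> n2 * w + r * n1"
proof -
  have inv: "amc_inv A M w p (foldl (amc_step n1 M Lams) ([], 0, [], {}) [0..<p])" if "p \<le> n2" for p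
    using that
  proof (induction p)
    case 0
    show ?case by (simp add: amc_inv_def lin_indep_def)
  next
    case (Suc p)
    then show ?case using amc_step_inv[OF A M Lams] by simp
  qed
  obtain Bs k cs obs where st: "foldl (amc_step n1 M Lams) ([], 0, [], {}) [0..<n2] = (Bs, k, cs, obs)"
    by (rule prod_cases4)
  have dr: "dim_row A = n1" using A by simp
  have *: "amc_inv A M w n2 (Bs, k, cs, obs)" using inv[of n2] unfolding st by simp
  note * = *[unfolded amc_inv_def prod.case dr]
  have "k \<le> r" using * by (intro lin_indep_colspace_le[OF A]) auto
  have amc: "amc n1 n2 M Lams = (mat n1 n2 (\<lambda>(a, i). (cs ! i) $ a), obs)" unfolding amc_def st by simp
  show "fst (amc n1 n2 M Lams) $$ (a, i) = M a i" if "a < n1" "i < n2" for a i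
    unfolding amc using * that by simp
  show "finite (snd (amc n1 n2 M Lams))" unfolding amc using * by simp
  have "card obs \<le> n2 * w + k * n1" using * by blast
  also have "\<dots> \<le> n2 * w + r * n1" using \<open>k \<le> r\<close> by simp
  finally show "card (snd (amc n1 n2 M Lams)) \<le> n2 * w + r * n1" unfolding amc by simp
qed

section \<open>Jennrich's algorithm\<close>

text \<open>Bracketed as a product of two factors, the shape that \<open>penrose_pinv_mult\<close>
  takes.\<close>

definition sandwich :: "real mat \<Rightarrow> (nat \<Rightarrow> real) \<Rightarrow> real mat \<Rightarrow> real mat" where
  "sandwich A a B = A * (mat_diag (dim_col A) a * B\<^sup>T)"

lemma full_col_rank_sum:
  assumes A: "A \<in> carrier_mat n r" "full_col_rank A"
    and z: "\<forall>i<n. (\<Sum>l<r. A $$ (i, l) * z l) = 0" and l: "l < r"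
  shows "z l = 0"
proof -
  have "A *\<^sub>v vec r z = 0\<^sub>v n"
  proof (rule eq_vecI)
    fix i assume "i < dim_vec (0\<^sub>v n)"
    then have i: "i < n" by simp
    have "(A *\<^sub>v vec r z) $ i = (\<Sum>l<r. A $$ (i, l) * z l)"
      using mat_vec_index_sum[OF A(1) _ i, of "vec r z"] by simp
    then show "(A *\<^sub>v vec r z) $ i = 0\<^sub>v n $ i" using z i by simp
  qed (use A in simp)
  then have "vec r z = 0\<^sub>v r" by (rule full_col_rankD[OF A(2,1), rotated]) simp
  then have "vec r z $ l = 0" using l by simp
  then show ?thesis using l by simp
qed

lemma full_col_rank_col_nonzero:
  assumes A: "A \<in> carrier_mat n r" "full_col_rank A" and l: "l < r"
  shows "\<exists>i<n. A $$ (i, l) \<noteq> 0"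
proof (rule ccontr)
  assume "\<not> ?thesis"
  then have "A $$ (i, l) = 0" if "i < n" for i using that by blast
  moreover have "(\<Sum>m<r. A $$ (i, m) * (if m = l then 1 else 0)) = A $$ (i, l)" for i
    using l by (simp add: if_distrib cong: if_cong)
  ultimately show False
    using full_col_rank_sum[OF A _ l, of "\<lambda>m. if m = l then 1 else 0"] by simp
qed

lemma sandwich_index:
  assumes "A \<in> carrier_mat n r" "B \<in> carrier_mat m r" "i < n" "j < m"
  shows "sandwich A a B $$ (i, j) = (\<Sum>l<r. A $$ (i, l) * a l * B $$ (j, l))"
proof -
  have BT: "B\<^sup>T \<in> carrier_mat r m" using assms by simp
  have "mat_diag r a * B\<^sup>T = mat r m (\<lambda>(l, j). a l * B $$ (j, l))"
    unfolding mat_diag_mult_left[OF BT] using assms by (intro eq_matI) auto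
  then show ?thesis using assms
    by (auto simp: sandwich_def scalar_prod_def lessThan_atLeast0 mult.assoc intro!: sum.cong)
qed

lemma sandwich_carrier: "\<lbrakk>A \<in> carrier_mat n r; B \<in> carrier_mat m r\<rbrakk> \<Longrightarrow> sandwich A a B \<in> carrier_mat n m"
  by (auto simp: sandwich_def)

lemma sandwich_transpose:
  assumes "A \<in> carrier_mat n r" "B \<in> carrier_mat m r"
  shows "(sandwich A a B)\<^sup>T = sandwich B a A"
proof (rule eq_matI)
  note c = sandwich_carrier[OF assms, of a] sandwich_carrier[OF assms(2,1), of a]
  show "dim_row (sandwich A a B)\<^sup>T = dim_row (sandwich B a A)"
    "dim_col (sandwich A a B)\<^sup>T = dim_col (sandwich B a A)" using c by simp_all
  fix i j assume "i < dim_row (sandwich B a A)" "j < dim_col (sandwich B a A)"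
  then have ij: "i < m" "j < n" using c by auto
  then have "(sandwich A a B)\<^sup>T $$ (i, j) = sandwich A a B $$ (j, i)" using c by simp
  also have "\<dots> = sandwich B a A $$ (i, j)"
    unfolding sandwich_index[OF assms ij(2,1)] sandwich_index[OF assms(2,1) ij] by (simp add: mult_ac)
  finally show "(sandwich A a B)\<^sup>T $$ (i, j) = sandwich B a A $$ (i, j)" .
qed

text \<open>Writing \<open>X\<^sub>a = H X\<^sub>b\<close> and \<open>A = X\<^sub>b Z\<close>, only the identity \<open>X\<^sub>b X\<^sub>b\<^sup>+ X\<^sub>b = X\<^sub>b\<close> is needed to see
  that \<open>X\<^sub>a X\<^sub>b\<^sup>+\<close> acts diagonally on the columns of \<open>A\<close>.\<close>
lemma sandwich_pinv_mult:
  assumes A: "A \<in> carrier_mat n r" "full_col_rank A" and B: "B \<in> carrier_mat m r" "full_col_rank B"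
    and b: "\<forall>l<r. b l \<noteq> 0"
  shows "sandwich A a B * pinv (sandwich A b B) * A = A * mat_diag r (\<lambda>l. a l / b l)"
    and "pinv (sandwich A b B) \<in> carrier_mat m n"
proof -
  let ?D = "mat_diag r"
  have BT: "B\<^sup>T \<in> carrier_mat r m" using B by simp
  have inv: "?D b * ?D (\<lambda>l. 1 / b l) = 1\<^sub>m r"
    unfolding mat_diag_diag using b by (intro eq_matI) (auto simp: mat_diag_def)
  have quot: "?D (\<lambda>l. a l / b l) * ?D b = ?D a"
    unfolding mat_diag_diag using b by (intro eq_matI) (auto simp: mat_diag_def)
  define Xa Xb where "Xa = A * (?D a * B\<^sup>T)" and "Xb = A * (?D b * B\<^sup>T)"
  have X: "sandwich A a B = Xa" "sandwich A b B = Xb" using A by (simp_all add: sandwich_def Xa_def Xb_def)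
  have Xc: "Xa \<in> carrier_mat n m" "Xb \<in> carrier_mat n m" using A BT by (auto simp: Xa_def Xb_def)
  have "full_col_rank ((?D b * B\<^sup>T)\<^sup>T)"
    unfolding full_col_rank_def
  proof (intro ballI impI)
    have e: "(?D b * B\<^sup>T)\<^sup>T = mat m r (\<lambda>(i, l). b l * B $$ (i, l))"
      unfolding mat_diag_mult_left[OF BT] using B by (intro eq_matI) auto
    fix c assume c: "c \<in> carrier_vec (dim_col ((?D b * B\<^sup>T)\<^sup>T))"
      and z: "(?D b * B\<^sup>T)\<^sup>T *\<^sub>v c = 0\<^sub>v (dim_row ((?D b * B\<^sup>T)\<^sup>T))"
    have cr: "c \<in> carrier_vec r" using c unfolding e by simp
    have "(\<Sum>l<r. B $$ (i, l) * (b l * c $ l)) = 0" if i: "i < m" for i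
    proof -
      have "(mat m r (\<lambda>(i, l). b l * B $$ (i, l)) *\<^sub>v c) $ i = 0" using z i unfolding e by simp
      moreover have "(mat m r (\<lambda>(i, l). b l * B $$ (i, l)) *\<^sub>v c) $ i = (\<Sum>l<r. B $$ (i, l) * (b l * c $ l))"
        unfolding mat_vec_index_sum[OF mat_carrier cr i]
        by (rule sum.cong[OF refl]) (use i in simp)
      ultimately show ?thesis by simp
    qed
    then have "\<forall>i<m. (\<Sum>l<r. B $$ (i, l) * (b l * c $ l)) = 0" by simp
    note full_col_rank_sum[OF B this]
    then show "c = 0\<^sub>v (dim_col ((?D b * B\<^sup>T)\<^sup>T))"
      unfolding e using b cr by (intro eq_vecI) auto
  qed
  moreover have G: "?D b * B\<^sup>T \<in> carrier_mat r m" using BT by (rule mult_carrier_mat[OF mat_diag_dim])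
  ultimately have "penrose Xb (pinv Xb)" unfolding Xb_def by (intro penrose_pinv_mult[OF A])
  then have Y: "pinv Xb \<in> carrier_mat m n" and pen: "Xb * pinv Xb * Xb = Xb"
    using Xc by (auto simp: penrose_def)
  then show "pinv (sandwich A b B) \<in> carrier_mat m n" by (simp add: X)
  obtain P where P: "P \<in> carrier_mat r r" "P * (A\<^sup>T * A) = 1\<^sub>m r"
    by (rule gram_inverse[OF A])
  define L where "L = P * A\<^sup>T"
  have L: "L \<in> carrier_mat r n" using P A by (auto simp: L_def)
  have LA: "L * A = 1\<^sub>m r" unfolding L_def using P A by (subst assoc_mult_mat) auto
  obtain Q where Q: "Q \<in> carrier_mat r r" "(B\<^sup>T * B) * Q = 1\<^sub>m r"
    by (rule gram_inverse[OF B])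
  define R where "R = B * Q"
  have R: "R \<in> carrier_mat m r" using Q B by (auto simp: R_def)
  have BR: "B\<^sup>T * R = 1\<^sub>m r" unfolding R_def using Q B by (subst assoc_mult_mat[symmetric]) auto
  \<comment> \<open>\<open>R\<close> is a right inverse of \<open>B\<^sup>T\<close>, so
    \<open>Z\<close> undoes the right half of \<open>Xb\<close> and leaves \<open>A\<close>.\<close>
  define Z where "Z = R * ?D (\<lambda>l. 1 / b l)"
  have Z: "Z \<in> carrier_mat m r" using R by (simp add: Z_def)
  have "Xb * Z = A * (?D b * (B\<^sup>T * R * ?D (\<lambda>l. 1 / b l)))"
    unfolding Xb_def Z_def using A BT R G
    by (simp add: assoc_mult_mat[OF A(1) G, of _ r] assoc_mult_mat[OF mat_diag_dim BT, of _ r]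
        assoc_mult_mat[OF BT R, of _ r])
  then have XZ: "Xb * Z = A" unfolding BR left_mult_one_mat[OF mat_diag_dim] inv right_mult_one_mat[OF A(1)] .
  \<comment> \<open>\<open>L\<close> is a left inverse of \<open>A\<close>, so \<open>H\<close>
    multiplies column \<open>l\<close> of \<open>A\<close> by \<open>a l / b l\<close> and turns
    \<open>Xb\<close> into \<open>Xa\<close>.\<close>
  define H where "H = A * (?D (\<lambda>l. a l / b l) * L)"
  have H: "H \<in> carrier_mat n n" using A L by (auto simp: H_def)
  have DL: "?D (\<lambda>l. a l / b l) * L \<in> carrier_mat r n" using L by (rule mult_carrier_mat[OF mat_diag_dim])
  have HA: "H * A = A * ?D (\<lambda>l. a l / b l)"
    unfolding H_def assoc_mult_mat[OF A(1) DL A(1)] assoc_mult_mat[OF mat_diag_dim L A(1)] LA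
      right_mult_one_mat[OF mat_diag_dim] ..
  have "H * Xb = (H * A) * (?D b * B\<^sup>T)" unfolding Xb_def by (rule assoc_mult_mat[OF H A(1) G, symmetric])
  also have "\<dots> = A * (?D (\<lambda>l. a l / b l) * (?D b * B\<^sup>T))"
    unfolding HA by (rule assoc_mult_mat[OF A(1) mat_diag_dim G])
  also have "?D (\<lambda>l. a l / b l) * (?D b * B\<^sup>T) = ?D a * B\<^sup>T"
    unfolding assoc_mult_mat[OF mat_diag_dim mat_diag_dim BT, symmetric] quot ..
  finally have HX: "H * Xb = Xa" unfolding Xa_def .
  have XY: "Xb * pinv Xb \<in> carrier_mat n n" using Xc Y by auto
  have "Xa * pinv Xb * A = (H * Xb * pinv Xb) * (Xb * Z)" unfolding HX XZ ..
  also have "\<dots> = (H * (Xb * pinv Xb)) * (Xb * Z)" unfolding assoc_mult_mat[OF H Xc(2) Y] ..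
  also have "\<dots> = H * ((Xb * pinv Xb) * (Xb * Z))"
    using Xc Z by (intro assoc_mult_mat[OF H XY]) auto
  also have "(Xb * pinv Xb) * (Xb * Z) = (Xb * pinv Xb * Xb) * Z"
    by (rule assoc_mult_mat[OF XY Xc(2) Z, symmetric])
  also have "\<dots> = A" unfolding pen XZ ..
  also note HA
  finally show "sandwich A a B * pinv (sandwich A b B) * A = A * ?D (\<lambda>l. a l / b l)" unfolding X .
qed

lemma sandwich_pinv_eigenvector:
  assumes A: "A \<in> carrier_mat n r" "full_col_rank A" and B: "B \<in> carrier_mat m r" "full_col_rank B"
    and b: "\<forall>l<r. b l \<noteq> 0" and l: "l < r"
  shows "eigenvector (sandwich A a B * pinv (sandwich A b B)) (col A l) (a l / b l)"
proof -
  let ?M = "sandwich A a B * pinv (sandwich A b B)"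
  note pm = sandwich_pinv_mult[OF A B b]
  have M: "?M \<in> carrier_mat n n" using sandwich_carrier[OF A(1) B(1)] pm(2) by (rule mult_carrier_mat)
  obtain i where "i < n" "A $$ (i, l) \<noteq> 0" using full_col_rank_col_nonzero[OF A l] by blast
  then have "col A l $ i \<noteq> 0\<^sub>v n $ i" using A l by simp
  then have nz: "col A l \<noteq> 0\<^sub>v n" by auto
  have "?M *\<^sub>v col A l = col (?M * A) l" using col_mult2[OF M A(1) l] by simp
  also have "\<dots> = col (A * mat_diag r (\<lambda>l. a l / b l)) l" by (simp only: pm(1)[of a])
  also have "\<dots> = (a l / b l) \<cdot>\<^sub>v col A l"
    unfolding mat_diag_mult_right[OF A(1)] using A l by (intro eq_vecI) auto
  finally show ?thesis
    using sandwich_carrier[OF A(1) B(1), of a] A nz by (auto simp: eigenvector_def)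
qed

text \<open>A nonzero eigenvalue forces the eigenvector into the column space of \<open>A\<close>.
  There the matrix acts diagonally in the coordinates given by the columns, and distinct ratios
  leave only one nonzero coordinate.\<close>

lemma sandwich_pinv_eigenvectorD:
  assumes A: "A \<in> carrier_mat n r" "full_col_rank A" and B: "B \<in> carrier_mat m r" "full_col_rank B"
    and b: "\<forall>l<r. b l \<noteq> 0" and inj: "inj_on (\<lambda>l. a l / b l) {..<r}"
    and ev: "eigenvector (sandwich A a B * pinv (sandwich A b B)) x lam" and lam: "lam \<noteq> 0"
  obtains l \<gamma> where "l < r" "lam = a l / b l" "\<gamma> \<noteq> 0" "\<And>i. i < n \<Longrightarrow> x $ i = \<gamma> * A $$ (i, l)"
proof -
  let ?S = "sandwich A a B" and ?Y = "pinv (sandwich A b B)"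
  let ?M = "?S * ?Y"
  note pm = sandwich_pinv_mult[OF A B b]
  have S: "?S \<in> carrier_mat n m" by (rule sandwich_carrier[OF A(1) B(1)])
  have M: "?M \<in> carrier_mat n n" using S pm(2) by (rule mult_carrier_mat)
  have x: "x \<in> carrier_vec n" "x \<noteq> 0\<^sub>v n" "?M *\<^sub>v x = lam \<cdot>\<^sub>v x"
    using ev M by (auto simp: eigenvector_def)
  \<comment> \<open>Coordinates of \<open>x\<close>, read off from the eigenvalue equation by
    stripping the leading factor \<open>A\<close> of the matrix.\<close>
  define c where "c = (1 / lam) \<cdot>\<^sub>v ((mat_diag r a * B\<^sup>T) *\<^sub>v (?Y *\<^sub>v x))"
  have G: "mat_diag r a * B\<^sup>T \<in> carrier_mat r m" using B by (intro mult_carrier_mat[OF mat_diag_dim]) simp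
  have Yx: "?Y *\<^sub>v x \<in> carrier_vec m" using pm(2) x by simp
  have c: "c \<in> carrier_vec r" using G Yx by (simp add: c_def)
  have Ac: "A *\<^sub>v c = x"
  proof -
    have "A *\<^sub>v c = (1 / lam) \<cdot>\<^sub>v (A *\<^sub>v ((mat_diag r a * B\<^sup>T) *\<^sub>v (?Y *\<^sub>v x)))"
      unfolding c_def using G Yx by (intro mult_mat_vec[OF A(1)]) auto
    also have "A *\<^sub>v ((mat_diag r a * B\<^sup>T) *\<^sub>v (?Y *\<^sub>v x)) = ?S *\<^sub>v (?Y *\<^sub>v x)"
      using A assoc_mult_mat_vec[OF A(1) G Yx] by (simp add: sandwich_def)
    also have "\<dots> = ?M *\<^sub>v x" using assoc_mult_mat_vec[OF S pm(2) x(1)] by simp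
    also have "(1 / lam) \<cdot>\<^sub>v (?M *\<^sub>v x) = x" unfolding x(3) using lam by (simp add: smult_smult_assoc)
    finally show ?thesis .
  qed
  let ?D = "mat_diag r (\<lambda>l. a l / b l)"
  have Dc: "?D *\<^sub>v c \<in> carrier_vec r" using c mult_mat_vec_carrier[OF mat_diag_dim] by blast
  have "A *\<^sub>v (?D *\<^sub>v c) = ?M *\<^sub>v (A *\<^sub>v c)"
    unfolding assoc_mult_mat_vec[OF A(1) mat_diag_dim c, symmetric]
      assoc_mult_mat_vec[OF M A(1) c, symmetric] pm(1)[of a] ..
  also have "\<dots> = A *\<^sub>v (lam \<cdot>\<^sub>v c)" unfolding Ac x(3) using mult_mat_vec[OF A(1) c] Ac by simp
  finally have "A *\<^sub>v (?D *\<^sub>v c - lam \<cdot>\<^sub>v c) = 0\<^sub>v n"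
    using mult_minus_distrib_mat_vec[OF A(1) Dc, of "lam \<cdot>\<^sub>v c"] c A by simp
  then have z: "?D *\<^sub>v c - lam \<cdot>\<^sub>v c = 0\<^sub>v r"
    using full_col_rankD[OF A(2,1)] Dc c by auto
  have ev': "(a l / b l - lam) * c $ l = 0" if l: "l < r" for l
  proof -
    have "(?D *\<^sub>v c) $ l = (\<Sum>k<r. ?D $$ (l, k) * c $ k)"
      by (rule mat_vec_index_sum[OF mat_diag_dim c l])
    also have "\<dots> = (\<Sum>k<r. if k = l then a l / b l * c $ l else 0)"
      using l by (intro sum.cong) (auto simp: mat_diag_def)
    also have "\<dots> = a l / b l * c $ l" using l by simp
    finally have "(?D *\<^sub>v c - lam \<cdot>\<^sub>v c) $ l = a l / b l * c $ l - lam * c $ l" using l c by simp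
    then show ?thesis unfolding z using l by (simp add: left_diff_distrib)
  qed
  have "\<exists>l<r. c $ l \<noteq> 0"
  proof (rule ccontr)
    assume "\<not> ?thesis"
    then have "c $ l = 0" if "l < r" for l using that by blast
    then have c0: "c = 0\<^sub>v r" by (intro eq_vecI) (use c in auto)
    have "x = A *\<^sub>v 0\<^sub>v r" unfolding c0[symmetric] Ac ..
    also have "\<dots> = 0\<^sub>v n" using A(1) by (intro eq_vecI) auto
    finally show False using x(2) by simp
  qed
  then obtain l where l: "l < r" "c $ l \<noteq> 0" by blast
  then have le: "lam = a l / b l" using ev'[OF l(1)] by simp
  have others: "c $ k = 0" if k: "k < r" "k \<noteq> l" for k
  proof -
    have "a k / b k \<noteq> a l / b l" using inj k l(1) by (auto simp: inj_on_def)
    then show ?thesis using ev'[OF k(1)] le by simp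
  qed
  have xi: "x $ i = c $ l * A $$ (i, l)" if i: "i < n" for i
  proof -
    have "x $ i = (\<Sum>k<r. A $$ (i, k) * c $ k)" using mat_vec_index_sum[OF A(1) c i] Ac by simp
    also have "\<dots> = (\<Sum>k<r. if k = l then A $$ (i, l) * c $ l else 0)"
      using others by (intro sum.cong) auto
    also have "\<dots> = c $ l * A $$ (i, l)" using l by simp
    finally show ?thesis .
  qed
  show ?thesis by (rule that[OF l(1) le l(2) xi])
qed

text \<open>The ambiguity left by the eigenvector computation: scalings are independent in the two
  modes, but the permutation is common to both, which is what the pairing achieves.\<close>

definition rescaled_factors :: "nat \<Rightarrow> nat \<Rightarrow> nat \<Rightarrow> real mat \<Rightarrow> real mat \<Rightarrow> real mat \<Rightarrow> real mat \<Rightarrow>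
    (nat \<Rightarrow> nat) \<Rightarrow> (nat \<Rightarrow> real) \<Rightarrow> (nat \<Rightarrow> real) \<Rightarrow> bool" where
  "rescaled_factors n1 n2 r A1 A2 B1 B2 \<sigma> \<gamma>1 \<gamma>2 \<longleftrightarrow>
     B1 \<in> carrier_mat n1 r \<and> B2 \<in> carrier_mat n2 r \<and> bij_betw \<sigma> {..<r} {..<r} \<and>
     (\<forall>l<r. \<gamma>1 l \<noteq> 0 \<and> \<gamma>2 l \<noteq> 0 \<and> (\<forall>i<n1. B1 $$ (i, l) = \<gamma>1 l * A1 $$ (i, \<sigma> l)) \<and>
       (\<forall>i<n2. B2 $$ (i, l) = \<gamma>2 l * A2 $$ (i, \<sigma> l)))"

locale generic_pencil =
  fixes n1 n2 r :: nat and A1 A2 :: "real mat" and a b :: "nat \<Rightarrow> real"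
  assumes A1: "A1 \<in> carrier_mat n1 r" "full_col_rank A1" and A2: "A2 \<in> carrier_mat n2 r" "full_col_rank A2"
    and a: "\<forall>l<r. a l \<noteq> 0" and b: "\<forall>l<r. b l \<noteq> 0" and inj: "inj_on (\<lambda>l. a l / b l) {..<r}"
begin

abbreviation "M1 \<equiv> sandwich A1 a A2 * pinv (sandwich A1 b A2)"
text \<open>Transposing the slice combinations makes the columns of \<open>A2\<close> the
  eigenvectors; exchanging \<open>a\<close> and \<open>b\<close> makes the eigenvalues reciprocal to
  those of \<open>M1\<close>.\<close>

abbreviation "M2 \<equiv> sandwich A2 b A1 * pinv (sandwich A2 a A1)"

lemma inj': "inj_on (\<lambda>l. b l / a l) {..<r}"
proof (rule inj_onI)
  fix l m assume lm: "l \<in> {..<r}" "m \<in> {..<r}" and "b l / a l = b m / a m"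
  then have "a l / b l = a m / b m" using a b by (auto simp: field_simps)
  then show "l = m" using inj lm by (auto dest: inj_onD)
qed

lemma M1_eigenvector: "l < r \<Longrightarrow> eigenvector M1 (col A1 l) (a l / b l)"
  by (rule sandwich_pinv_eigenvector[OF A1 A2 b])

lemma M2_eigenvector: "l < r \<Longrightarrow> eigenvector M2 (col A2 l) (b l / a l)"
  by (rule sandwich_pinv_eigenvector[OF A2 A1 a])

lemma paired_eigenvalues:
  "{lam. lam \<noteq> 0 \<and> (\<exists>x. eigenvector M1 x lam) \<and> (\<exists>y. eigenvector M2 y (1 / lam))} = (\<lambda>l. a l / b l) ` {..<r}"
  (is "?E = ?R")
proof
  show "?E \<subseteq> ?R"
  proof
    fix lam assume "lam \<in> ?E"
    then obtain x where x: "lam \<noteq> 0" "eigenvector M1 x lam" by blast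
    obtain l \<gamma> where "l < r" "lam = a l / b l"
      by (rule sandwich_pinv_eigenvectorD[OF A1 A2 b inj x(2,1)])
    then show "lam \<in> ?R" by blast
  qed
  show "?R \<subseteq> ?E"
  proof
    fix lam assume "lam \<in> ?R"
    then obtain l where l: "l < r" "lam = a l / b l" by auto
    then have "lam \<noteq> 0" "1 / lam = b l / a l" using a b by auto
    then show "lam \<in> ?E" using M1_eigenvector[OF l(1)] M2_eigenvector[OF l(1)] l(2) by auto
  qed
qed

context
  fixes s :: nat and X :: "nat \<Rightarrow> nat \<Rightarrow> nat \<Rightarrow> real" and u v :: "nat \<Rightarrow> real"
  assumes Xu: "slice_comb n1 n2 s X u = sandwich A1 a A2" and Xv: "slice_comb n1 n2 s X v = sandwich A1 b A2"
begin

lemma jennrich_out_iff: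
  "jennrich_out n1 n2 s X u v B1 B2 \<longleftrightarrow> (\<exists>lams. distinct lams \<and> set lams = (\<lambda>l. a l / b l) ` {..<r} \<and>
     B1 \<in> carrier_mat n1 (length lams) \<and> B2 \<in> carrier_mat n2 (length lams) \<and>
     (\<forall>l < length lams. eigenvector M1 (col B1 l) (lams ! l) \<and> eigenvector M2 (col B2 l) (1 / lams ! l)))"
  unfolding jennrich_out_def Let_def Xu Xv sandwich_transpose[OF A1(1) A2(1)] paired_eigenvalues ..

lemma jennrich_out_factors: "jennrich_out n1 n2 s X u v A1 A2"
proof -
  let ?l = "map (\<lambda>l. a l / b l) [0..<r]"
  have "distinct ?l" using inj by (simp add: distinct_map lessThan_atLeast0)
  moreover have "set ?l = (\<lambda>l. a l / b l) ` {..<r}" by (simp add: lessThan_atLeast0)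
  moreover have "eigenvector M1 (col A1 l) (?l ! l) \<and> eigenvector M2 (col A2 l) (1 / ?l ! l)" if "l < r" for l
    using M1_eigenvector[OF that] M2_eigenvector[OF that] that by simp
  ultimately show ?thesis unfolding jennrich_out_iff using A1(1) A2(1)
    by (intro exI[of _ ?l]) simp
qed

text \<open>Each listed eigenvalue singles out one column index in mode 1, and its reciprocal one in
  mode 2. They agree because the ratios \<open>b l / a l\<close> are also distinct, so a single
  \<sigma> serves both factors.\<close>

lemma jennrich_out_rescaled:
  assumes "jennrich_out n1 n2 s X u v B1 B2"
  shows "\<exists>\<sigma> \<gamma>1 \<gamma>2. rescaled_factors n1 n2 r A1 A2 B1 B2 \<sigma> \<gamma>1 \<gamma>2"
proof -
  obtain lams where lams: "distinct lams" "set lams = (\<lambda>l. a l / b l) ` {..<r}"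
    and B: "B1 \<in> carrier_mat n1 (length lams)" "B2 \<in> carrier_mat n2 (length lams)"
    and ev: "\<forall>l < length lams. eigenvector M1 (col B1 l) (lams ! l) \<and> eigenvector M2 (col B2 l) (1 / lams ! l)"
    using assms unfolding jennrich_out_iff by blast
  have len: "length lams = r" using lams inj distinct_card[OF lams(1)] by (simp add: card_image)
  define Q where "Q l k g1 g2 \<longleftrightarrow> k < r \<and> lams ! l = a k / b k \<and> g1 \<noteq> 0 \<and> g2 \<noteq> 0 \<and>
      (\<forall>i<n1. B1 $$ (i, l) = g1 * A1 $$ (i, k)) \<and> (\<forall>i<n2. B2 $$ (i, l) = g2 * A2 $$ (i, k))"
    for l k g1 g2
  have "\<exists>k g1 g2. Q l k g1 g2" if l: "l < r" for l
  proof -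
    have "lams ! l \<in> set lams" using l len by simp
    then have nz: "lams ! l \<noteq> 0" "1 / lams ! l \<noteq> 0" using lams(2) a b by auto
    have e1: "eigenvector M1 (col B1 l) (lams ! l)" and e2: "eigenvector M2 (col B2 l) (1 / lams ! l)"
      using ev l len by auto
    obtain k g1 where k: "k < r" "lams ! l = a k / b k" "g1 \<noteq> 0"
      and c1: "\<And>i. i < n1 \<Longrightarrow> col B1 l $ i = g1 * A1 $$ (i, k)"
      by (rule sandwich_pinv_eigenvectorD[OF A1 A2 b inj e1 nz(1)]) (rule that)
    obtain k' g2 where k': "k' < r" "1 / lams ! l = b k' / a k'" "g2 \<noteq> 0"
      and c2: "\<And>i. i < n2 \<Longrightarrow> col B2 l $ i = g2 * A2 $$ (i, k')"
      by (rule sandwich_pinv_eigenvectorD[OF A2 A1 a inj' e2 nz(2)]) (rule that)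
    have "b k / a k = b k' / a k'" using k k' by simp
    then have "k = k'" using inj_onD[OF inj', of k k'] k k' by simp
    moreover have "B1 $$ (i, l) = g1 * A1 $$ (i, k)" if "i < n1" for i
      using c1[OF that] B(1) that l len by simp
    moreover have "B2 $$ (i, l) = g2 * A2 $$ (i, k')" if "i < n2" for i
      using c2[OF that] B(2) that l len by simp
    ultimately have "Q l k g1 g2" using k k' by (simp add: Q_def)
    then show ?thesis by blast
  qed
  then have "\<forall>l\<in>{..<r}. \<exists>k g1 g2. Q l k g1 g2" by simp
  then have "\<exists>\<sigma> \<gamma>1 \<gamma>2. \<forall>l\<in>{..<r}. Q l (\<sigma> l) (\<gamma>1 l) (\<gamma>2 l)" by (simp only: bchoice_iff)
  then obtain \<sigma> \<gamma>1 \<gamma>2 where Q: "\<forall>l\<in>{..<r}. Q l (\<sigma> l) (\<gamma>1 l) (\<gamma>2 l)" by blast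
  then have \<sigma>: "\<sigma> l < r" "lams ! l = a (\<sigma> l) / b (\<sigma> l)" if "l < r" for l
    using that by (auto simp: Q_def)
  have "inj_on \<sigma> {..<r}"
  proof (rule inj_onI)
    fix l m assume lm: "l \<in> {..<r}" "m \<in> {..<r}" "\<sigma> l = \<sigma> m"
    then have "lams ! l = lams ! m" using \<sigma>(2)[of l] \<sigma>(2)[of m] by simp
    then show "l = m" using nth_eq_iff_index_eq[OF lams(1), of l m] lm len by simp
  qed
  moreover have "\<sigma> ` {..<r} \<subseteq> {..<r}" using \<sigma>(1) by auto
  ultimately have "bij_betw \<sigma> {..<r} {..<r}"
    by (simp add: bij_betw_def endo_inj_surj)
  then have "rescaled_factors n1 n2 r A1 A2 B1 B2 \<sigma> \<gamma>1 \<gamma>2"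
    using Q B len by (auto simp: rescaled_factors_def Q_def)
  then show ?thesis by blast
qed

end

end

section \<open>The third factor\<close>

text \<open>The Khatri-Rao product has trivial kernel: fix a row \<open>j\<close> with
  \<open>A2 $$ (j, l)\<close> nonzero; the equations for the pairs \<open>(i, j)\<close> say that
  the scaled \<open>z\<close> is in the kernel of \<open>A1\<close>.\<close>

lemma kr_row_selection:
  assumes A1: "A1 \<in> carrier_mat n1 r" "full_col_rank A1" and A2: "A2 \<in> carrier_mat n2 r" "full_col_rank A2"
  shows "\<exists>L. L \<subseteq> {..<n1} \<times> {..<n2} \<and> card L = r \<and> kr_rows_indep A1 A2 L"
proof -
  let ?a = "\<lambda>p l. A1 $$ (fst p, l) * A2 $$ (snd p, l)"
  have "\<forall>l\<in>{..<r}. z l = 0" if z: "\<forall>p\<in>{..<n1} \<times> {..<n2}. (\<Sum>l\<in>{..<r}. ?a p l * z l) = 0" for z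
  proof
    fix l assume "l \<in> {..<r}"
    then have l: "l < r" by simp
    obtain j where j: "j < n2" "A2 $$ (j, l) \<noteq> 0" using full_col_rank_col_nonzero[OF A2 l] by blast
    have "\<forall>i<n1. (\<Sum>l<r. A1 $$ (i, l) * (A2 $$ (j, l) * z l)) = 0"
      using z j(1) by (auto simp: mult.assoc)
    from full_col_rank_sum[OF A1 this l] j(2) show "z l = 0" by simp
  qed
  from row_selection[of "{..<n1} \<times> {..<n2}" "{..<r}" ?a, OF _ _ this]
  have "\<exists>L. L \<subseteq> {..<n1} \<times> {..<n2} \<and> card L = card {..<r} \<and>
    (\<forall>d. (\<forall>l\<in>{..<r}. (\<Sum>p\<in>L. d p * ?a p l) = 0) \<longrightarrow> (\<forall>p\<in>L. d p = 0))"
    by (simp only: finite_cartesian_product finite_lessThan simp_thms)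
  then obtain L where L: "L \<subseteq> {..<n1} \<times> {..<n2}" "card L = r"
    "\<forall>d. (\<forall>l\<in>{..<r}. (\<Sum>p\<in>L. d p * ?a p l) = 0) \<longrightarrow> (\<forall>p\<in>L. d p = 0)"
    unfolding card_lessThan by blast
  have dc: "dim_col A1 = r" using A1(1) by simp
  have "kr_rows_indep A1 A2 L"
    unfolding kr_rows_indep_def case_prod_beta dc
  proof (intro allI impI)
    fix d :: "nat \<times> nat \<Rightarrow> real"
    assume "\<forall>l<r. (\<Sum>p\<in>L. d (fst p, snd p) * (A1 $$ (fst p, l) * A2 $$ (snd p, l))) = 0"
    then show "\<forall>p\<in>L. d p = 0" by (intro L(3)[THEN spec, THEN mp]) simp
  qed
  with L show ?thesis by blast
qed

text \<open>The row of \<open>A3\<close>, permuted by \<sigma> and divided by the scalings, solves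
  the equations for all index pairs. The row of \<open>B3\<close> solves those in \<open>L\<close>,
  and the square system on \<open>L\<close> has only one solution.\<close>

lemma cp3_recovered:
  assumes A1: "A1 \<in> carrier_mat n1 r"
    and T: "\<forall>i1<n1. \<forall>i2<n2. \<forall>i3<n3. T i1 i2 i3 = cp3 A1 A2 A3 i1 i2 i3"
    and B: "rescaled_factors n1 n2 r A1 A2 B1 B2 \<sigma> \<gamma>1 \<gamma>2"
    and L: "L \<subseteq> {..<n1} \<times> {..<n2}" "card L = dim_col B1" "kr_rows_indep B1 B2 L"
    and B3: "\<forall>i3<n3. \<forall>(i1, i2)\<in>L. (\<Sum>l<dim_col B1. B1 $$ (i1, l) * B2 $$ (i2, l) * B3 $$ (i3, l)) = T i1 i2 i3"
    and i: "i1 < n1" "i2 < n2" "i3 < n3"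
  shows "cp3 B1 B2 B3 i1 i2 i3 = T i1 i2 i3"
proof -
  have dc: "dim_col B1 = r" and bij: "bij_betw \<sigma> {..<r} {..<r}" using B by (auto simp: rescaled_factors_def)
  define y where "y l = A3 $$ (i3, \<sigma> l) / (\<gamma>1 l * \<gamma>2 l)" for l
  have true: "(\<Sum>l<r. B1 $$ (j1, l) * B2 $$ (j2, l) * y l) = T j1 j2 i3" if j: "j1 < n1" "j2 < n2" for j1 j2
  proof -
    have "(\<Sum>l<r. B1 $$ (j1, l) * B2 $$ (j2, l) * y l)
        = (\<Sum>l<r. A1 $$ (j1, \<sigma> l) * A2 $$ (j2, \<sigma> l) * A3 $$ (i3, \<sigma> l))"
    proof (rule sum.cong[OF refl])
      fix l assume "l \<in> {..<r}"
      then have "\<gamma>1 l \<noteq> 0" "\<gamma>2 l \<noteq> 0" "B1 $$ (j1, l) = \<gamma>1 l * A1 $$ (j1, \<sigma> l)" "B2 $$ (j2, l) = \<gamma>2 l * A2 $$ (j2, \<sigma> l)"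
        using B j by (auto simp: rescaled_factors_def)
      then show "B1 $$ (j1, l) * B2 $$ (j2, l) * y l = A1 $$ (j1, \<sigma> l) * A2 $$ (j2, \<sigma> l) * A3 $$ (i3, \<sigma> l)"
        by (simp add: y_def)
    qed
    also have "\<dots> = (\<Sum>l<r. A1 $$ (j1, l) * A2 $$ (j2, l) * A3 $$ (i3, l))"
      by (rule sum.reindex_bij_betw[OF bij])
    also have "\<dots> = T j1 j2 i3" using T j i(3) A1 by (simp add: cp3_def)
    finally show ?thesis .
  qed
  define z where "z l = B3 $$ (i3, l) - y l" for l
  let ?a = "\<lambda>p l. B1 $$ (fst p, l) * B2 $$ (snd p, l)"
  have "\<forall>l\<in>{..<r}. z l = 0"
  proof (rule square_system_kernel[of L "{..<r}" ?a])
    show "finite L" by (rule finite_subset[OF L(1)]) simp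
    show "card L = card {..<r}" using L(2) dc by simp
    show "\<forall>p\<in>L. d p = 0" if "\<forall>l\<in>{..<r}. (\<Sum>p\<in>L. d p * ?a p l) = 0" for d
      using that by (intro L(3)[unfolded kr_rows_indep_def case_prod_beta dc, THEN spec, THEN mp]) simp
    show "\<forall>p\<in>L. (\<Sum>l\<in>{..<r}. ?a p l * z l) = 0"
    proof
      fix p assume p: "p \<in> L"
      then have "fst p < n1" "snd p < n2" using L(1) by auto
      note true[OF this]
      moreover have "(\<Sum>l<r. ?a p l * B3 $$ (i3, l)) = T (fst p) (snd p) i3"
        using B3[THEN spec, THEN mp, OF i(3), THEN bspec, OF p] unfolding dc case_prod_beta .
      ultimately show "(\<Sum>l\<in>{..<r}. ?a p l * z l) = 0"
        by (simp add: z_def right_diff_distrib sum_subtractf)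
    qed
  qed simp
  then have "B3 $$ (i3, l) = y l" if "l < r" for l using that by (simp add: z_def)
  then have "cp3 B1 B2 B3 i1 i2 i3 = (\<Sum>l<r. B1 $$ (i1, l) * B2 $$ (i2, l) * y l)"
    by (simp add: cp3_def dc)
  then show ?thesis using true[OF i(1,2)] by simp
qed

section \<open>The failure probability\<close>

lemma prob_not_determining:
  assumes A: "A \<in> carrier_mat n r" and pos: "0 < n" "0 < r" "0 < mu0" and \<delta>: "0 < \<delta>"
    and coh: "coherence A \<le> mu0" and w: "w = amc_w 3 mu0 r \<delta> n"
  shows "measure (measure_pmf (pmf_of_set {\<Lambda>. \<Lambda> \<subseteq> {..<n} \<and> card \<Lambda> = w}))
      {\<Lambda>. \<not> (determining A \<Lambda> \<and> \<Lambda> \<subseteq> {..<n} \<and> card \<Lambda> = w)} \<le> real r * (\<delta> / real r) ^ 3"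
proof -
  interpret coherent_subspace "colspace A" n r "mu0 * real r / real n"
    by (rule coherent_subspace_colspace[OF A pos coh])
  define F where "F = {\<Lambda>. \<Lambda> \<subseteq> {..<n} \<and> card \<Lambda> = w}"
  define bad where "bad = {\<Lambda>. \<not> (determining A \<Lambda> \<and> \<Lambda> \<subseteq> {..<n} \<and> card \<Lambda> = w)}"
  have wn: "w \<le> n" by (simp add: w amc_w_def)
  have fF: "finite F" unfolding F_def by (rule finite_subset[of _ "Pow {..<n}"]) auto
  have cF: "card F = n choose w" unfolding F_def using n_subsets[of "{..<n}" w] by simp
  then have "card F \<noteq> 0" using wn by simp
  then have neF: "F \<noteq> {}" by auto
  have dr: "dim_row A = n" using A by simp
  have Fbad: "F \<inter> bad = {\<Lambda>. \<Lambda> \<subseteq> {..<n} \<and> card \<Lambda> = w \<and>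
      (\<exists>x\<in>vanishing (colspace A) \<Lambda>. \<exists>i<n. x i \<noteq> 0)}"
    unfolding F_def bad_def determining_def vanishing_def dr by blast
  have meas: "measure (measure_pmf (pmf_of_set F)) bad = real (card (F \<inter> bad)) / real (n choose w)"
    using measure_pmf_of_set[OF neF fF] cF by simp
  have "measure (measure_pmf (pmf_of_set F)) bad \<le> real r * (\<delta> / real r) ^ 3"
  \<comment> \<open>When \<open>w\<close> is cut off at \<open>n\<close>, the exponential bound may
    be too weak for the claim; but then every row is sampled.\<close>
  proof (cases "w = n")
    case True
    have "F \<inter> bad = {}"
    proof (rule ccontr)
      assume "F \<inter> bad \<noteq> {}"
      then obtain \<Lambda> x i where L: "\<Lambda> \<subseteq> {..<n}" "card \<Lambda> = n" "x \<in> vanishing (colspace A) \<Lambda>" "i < n" "x i \<noteq> 0"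
        unfolding Fbad True by blast
      then have "\<Lambda> = {..<n}" by (intro card_subset_eq) auto
      with L show False by (auto simp: vanishing_def)
    qed
    then show ?thesis using \<delta> by (simp add: meas)
  next
    case False
    define x where "x = 3 * mu0 * real r * ln (real r / \<delta>)"
    have "w = nat \<lceil>x\<rceil>" using False wn unfolding w amc_w_def x_def by (auto simp: min_def split: if_splits)
    then have "x \<le> real w" using real_nat_ceiling_ge by simp
    then have "3 * ln (real r / \<delta>) \<le> real w / (mu0 * real r)"
      using pos by (simp add: x_def field_simps)
    \<comment> \<open>\<open>\<kappa> * n\<close> is \<open>mu0 * r\<close>, so \<open>n\<close>
      cancels from the exponent.\<close>
    then have "- real w / (mu0 * real r / real n * real n) \<le> - (3 * ln (real r / \<delta>))"
      using pos by simp
    then have "exp (- real w / (mu0 * real r / real n * real n)) \<le> exp (- (3 * ln (real r / \<delta>)))"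
      by simp
    also have "\<dots> = (\<delta> / real r) ^ 3"
    proof -
      have "exp (- (3 * ln (real r / \<delta>))) = exp (ln (\<delta> / real r)) ^ 3"
        using pos \<delta> by (simp add: exp_of_nat_mult[symmetric] ln_div)
      also have "exp (ln (\<delta> / real r)) = \<delta> / real r" using pos \<delta> by simp
      finally show ?thesis .
    qed
    finally have e: "exp (- real w / (mu0 * real r / real n * real n)) \<le> (\<delta> / real r) ^ 3" .
    have "0 < n choose w" using wn by simp
    then have "real (card (F \<inter> bad)) / real (n choose w) \<le> real r * exp (- real w / (mu0 * real r / real n * real n))"
      using card_bad_le[OF wn] unfolding Fbad by (simp add: divide_le_eq)
    also have "\<dots> \<le> real r * (\<delta> / real r) ^ 3" using e by (intro mult_left_mono) auto
    finally show ?thesis unfolding meas .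
  qed
  then show ?thesis unfolding F_def bad_def .
qed

section \<open>Genericity of Gaussian slice combinations\<close>

abbreviation std_normal :: "real measure" where
  "std_normal \<equiv> density lborel std_normal_density"

lemma prob_space_std_normal: "prob_space std_normal"
  using prob_space_normal_density[of 1 0] by simp

lemma prob_space_PiM_std_normal: "prob_space (PiM I (\<lambda>_. std_normal))"
  by (rule prob_space_PiM) (rule prob_space_std_normal)

text \<open>Integrate over coordinate \<open>k\<close> first: with the others fixed, the hyperplane
  contains a single value of it, and points are null.\<close>

lemma AE_std_normal_hyperplane:
  assumes I: "finite I" and k: "k \<in> I" "g k \<noteq> 0"
  shows "AE x in PiM I (\<lambda>_. std_normal). (\<Sum>i\<in>I. x i * g i) \<noteq> 0"
proof -
  let ?J = "I - {k}"
  interpret std: prob_space std_normal by (rule prob_space_std_normal)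
  interpret product_sigma_finite "\<lambda>_. std_normal" ..
  have Ik: "I = insert k ?J" using k by auto
  let ?N = "{x \<in> space (PiM I (\<lambda>_. std_normal)). (\<Sum>i\<in>I. x i * g i) = 0}"
  have N: "?N \<in> sets (PiM I (\<lambda>_. std_normal))" by measurable
  have null: "emeasure std_normal {c} = 0" for c
  proof -
    have "AE x in lborel. x \<in> {c} \<longrightarrow> ennreal (std_normal_density x) = 0"
      using AE_lborel_singleton[of c] by eventually_elim simp
    then have "{c} \<in> null_sets std_normal" by (subst null_sets_density_iff) simp_all
    then show ?thesis by (rule null_setsD1)
  qed
  have "emeasure (PiM I (\<lambda>_. std_normal)) ?N = (\<integral>\<^sup>+ x. indicator ?N x \<partial>PiM I (\<lambda>_. std_normal))"
    using N by simp
  also have "\<dots> = (\<integral>\<^sup>+ x. indicator ?N x \<partial>PiM (insert k ?J) (\<lambda>_. std_normal))"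
    using Ik by simp
  also have "\<dots> = (\<integral>\<^sup>+ x. (\<integral>\<^sup>+ y. indicator ?N (x(k := y)) \<partial>std_normal) \<partial>PiM ?J (\<lambda>_. std_normal))"
  proof (rule product_nn_integral_insert)
    show "indicator ?N \<in> borel_measurable (PiM (insert k ?J) (\<lambda>_. std_normal))"
      unfolding Ik[symmetric] using N by (rule borel_measurable_indicator)
  qed (use I in auto)
  also have "\<dots> = (\<integral>\<^sup>+ x. 0 \<partial>PiM ?J (\<lambda>_. std_normal))"
  proof (rule nn_integral_cong)
    fix x :: "'a \<Rightarrow> real"
    define c where "c = - (\<Sum>i\<in>?J. x i * g i) / g k"
    have "(\<integral>\<^sup>+ y. indicator ?N (x(k := y)) \<partial>std_normal) \<le> (\<integral>\<^sup>+ y. indicator {c} y \<partial>std_normal)"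
    proof (rule nn_integral_mono)
      fix y
      have "y = c" if "(\<Sum>i\<in>I. (x(k := y)) i * g i) = 0"
      proof -
        have "(\<Sum>i\<in>I. (x(k := y)) i * g i) = y * g k + (\<Sum>i\<in>?J. (x(k := y)) i * g i)"
          using sum.remove[OF I k(1), of "\<lambda>i. (x(k := y)) i * g i"] by simp
        also have "(\<Sum>i\<in>?J. (x(k := y)) i * g i) = (\<Sum>i\<in>?J. x i * g i)"
          by (rule sum.cong) auto
        finally show ?thesis using that k(2) by (simp add: c_def field_simps)
      qed
      then show "indicator ?N (x(k := y)) \<le> (indicator {c} y :: ennreal)"
        by (auto simp: indicator_def)
    qed
    also have "\<dots> = 0" using null[of c] by simp
    finally show "(\<integral>\<^sup>+ y. indicator ?N (x(k := y)) \<partial>std_normal) = 0" by simp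
  qed
  finally have "emeasure (PiM I (\<lambda>_. std_normal)) ?N = 0" by simp
  then show ?thesis using N by (intro AE_I[of _ _ ?N]) auto
qed

definition comb :: "nat \<Rightarrow> (nat \<Rightarrow> nat \<Rightarrow> real) \<Rightarrow> (nat \<Rightarrow> real) \<Rightarrow> nat \<Rightarrow> real" where
  "comb s c u l = (\<Sum>k<s. u k * c k l)"

text \<open>The last clause is distinctness of the ratios, cross-multiplied so that for a fixed
  first vector it is a linear condition on the second.\<close>

definition generic :: "nat \<Rightarrow> nat \<Rightarrow> (nat \<Rightarrow> nat \<Rightarrow> real) \<Rightarrow> (nat \<Rightarrow> real) \<times> (nat \<Rightarrow> real) \<Rightarrow> bool" where
  "generic s r c z \<longleftrightarrow> (\<forall>l<r. comb s c (fst z) l \<noteq> 0 \<and> comb s c (snd z) l \<noteq> 0 \<and>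
     (\<forall>m<r. l \<noteq> m \<longrightarrow> comb s c (fst z) l * comb s c (snd z) m \<noteq> comb s c (fst z) m * comb s c (snd z) l))"

text \<open>The ratio condition is bilinear and becomes a hyperplane condition on \<open>v\<close>
  only after \<open>u\<close> is fixed. Its normal vector combines two columns of \<open>c\<close>
  with coefficients that are not both zero, so \<open>pair\<close> makes it nonzero; Fubini then
  joins the two stages.\<close>

lemma AE_generic:
  fixes c :: "nat \<Rightarrow> nat \<Rightarrow> real"
  assumes r: "2 \<le> r"
    and pair: "\<And>l m \<alpha> \<beta>. \<lbrakk>l < r; m < r; l \<noteq> m; \<forall>k<s. \<alpha> * c k l + \<beta> * c k m = 0\<rbrakk> \<Longrightarrow> \<alpha> = 0 \<and> \<beta> = 0"
  defines "G \<equiv> PiM {..<s} (\<lambda>_. std_normal)"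
  shows "{z \<in> space (G \<Otimes>\<^sub>M G). generic s r c z} \<in> sets (G \<Otimes>\<^sub>M G)" and "AE z in G \<Otimes>\<^sub>M G. generic s r c z"
proof -
  interpret G: prob_space G unfolding G_def by (rule prob_space_PiM_std_normal)
  interpret GG: pair_sigma_finite G G ..
  have cm: "(\<lambda>u. comb s c u l) \<in> borel_measurable G" for l
    unfolding G_def comb_def by measurable
  have [measurable]: "(\<lambda>z. comb s c (fst z) l) \<in> borel_measurable (G \<Otimes>\<^sub>M G)"
    "(\<lambda>z. comb s c (snd z) l) \<in> borel_measurable (G \<Otimes>\<^sub>M G)" for l
    using measurable_compose[OF measurable_fst cm] measurable_compose[OF measurable_snd cm] by auto
  show M: "{z \<in> space (G \<Otimes>\<^sub>M G). generic s r c z} \<in> sets (G \<Otimes>\<^sub>M G)"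
    unfolding generic_def by measurable
  have hyper: "AE u in G. (\<Sum>k<s. u k * g k) \<noteq> 0" if "\<exists>k<s. g k \<noteq> 0" for g :: "nat \<Rightarrow> real"
  proof -
    from that obtain k where k: "k \<in> {..<s}" "g k \<noteq> 0" by auto
    from AE_std_normal_hyperplane[of "{..<s}" k g] show ?thesis using k unfolding G_def by simp
  qed
  have single: "AE u in G. comb s c u l \<noteq> 0" if l: "l < r" for l
  proof -
    \<comment> \<open>An arbitrary second column, available since \<open>r\<close> is at least 2; it
      enters \<open>pair\<close> with coefficient 0.\<close>
    define m where "m = (if l = 0 then 1 else 0 :: nat)"
    have m: "m < r" "l \<noteq> m" using r by (auto simp: m_def)
    have "\<exists>k<s. c k l \<noteq> 0" using pair[OF l m, of 1 0] by auto
    from hyper[OF this] show ?thesis by (simp add: comb_def)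
  qed
  then have s1: "AE u in G. \<forall>l\<in>{..<r}. comb s c u l \<noteq> 0"
    by (intro AE_finite_allI) auto
  have s2: "AE v in G. generic s r c (u, v)" if u: "\<forall>l\<in>{..<r}. comb s c u l \<noteq> 0" for u
  proof -
    have "AE v in G. comb s c u l * comb s c v m \<noteq> comb s c u m * comb s c v l"
      if lm: "l < r" "m < r" "l \<noteq> m" for l m
    proof -
      have ul: "comb s c u l \<noteq> 0" using u lm(1) by blast
      have "\<exists>k<s. - comb s c u m * c k l + comb s c u l * c k m \<noteq> 0"
        using pair[OF lm, of "- comb s c u m" "comb s c u l"] ul by blast
      from hyper[OF this] show ?thesis
      proof (rule AE_mp, intro AE_I2 impI)
        fix v assume "(\<Sum>k<s. v k * (- comb s c u m * c k l + comb s c u l * c k m)) \<noteq> 0"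
        moreover have "(\<Sum>k<s. v k * (- comb s c u m * c k l + comb s c u l * c k m))
            = comb s c u l * comb s c v m - comb s c u m * comb s c v l"
          unfolding comb_def[of s c v] by (simp add: sum_distrib_left sum_subtractf[symmetric] algebra_simps)
        ultimately show "comb s c u l * comb s c v m \<noteq> comb s c u m * comb s c v l" by simp
      qed
    qed
    then have "AE v in G. \<forall>p\<in>{(l, m). l < r \<and> m < r \<and> l \<noteq> m}.
        comb s c u (fst p) * comb s c v (snd p) \<noteq> comb s c u (snd p) * comb s c v (fst p)"
      by (intro AE_finite_allI[OF finite_subset[of _ "{..<r} \<times> {..<r}"]]) auto
    with s1 show ?thesis
    proof eventually_elim
      case (elim v)
      then show ?case using u by (auto simp: generic_def)
    qed
  qed
  show "AE z in G \<Otimes>\<^sub>M G. generic s r c z"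
  proof (rule GG.AE_pair_measure[OF M])
    show "AE u in G. AE v in G. generic s r c (u, v)"
      using s1 by eventually_elim (rule s2)
  qed
qed

section \<open>Union bound over the draws\<close>

lemma prob_all_draws:
  fixes p :: "'a pmf" and s r :: nat
  assumes bad: "measure (measure_pmf p) (- Q) \<le> \<epsilon>"
  defines "N \<equiv> PiM UNIV (\<lambda>_ :: nat \<times> nat. measure_pmf p)"
  shows "{f \<in> space N. \<forall>j<s. \<forall>k\<le>r. f (j, k) \<in> Q} \<in> sets N"
    and "1 - real s * real (Suc r) * \<epsilon> \<le> measure N {f \<in> space N. \<forall>j<s. \<forall>k\<le>r. f (j, k) \<in> Q}"
proof -
  interpret product_prob_space "\<lambda>_ :: nat \<times> nat. measure_pmf p" UNIV
    by (intro product_prob_spaceI) (rule measure_pmf.prob_space_axioms)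
  interpret N: prob_space N unfolding N_def by (rule prob_space_PiM) (rule measure_pmf.prob_space_axioms)
  have one: "{f \<in> space N. f q \<in> R} \<in> sets N" for q R
  proof -
    have "(\<lambda>f. f q) \<in> measurable N (measure_pmf p)" unfolding N_def by (rule measurable_component_singleton) simp
    from measurable_sets[OF this, of R] show ?thesis by (simp add: vimage_def Int_def conj_commute)
  qed
  \<comment> \<open>One draw for each possible number of stored columns, 0 to \<open>r\<close>, in
    each slice.\<close>
  let ?I = "{..<s} \<times> {..r}"
  let ?B = "\<lambda>q. {f \<in> space N. f q \<in> - Q}"
  let ?G = "{f \<in> space N. \<forall>j<s. \<forall>k\<le>r. f (j, k) \<in> Q}"
  have G: "?G = space N - (\<Union>q\<in>?I. ?B q)" by auto
  have U: "(\<Union>q\<in>?I. ?B q) \<in> sets N" by (rule sets.finite_UN) (use one in auto)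
  then show "?G \<in> sets N" unfolding G by auto
  have mB: "measure N (?B q) \<le> \<epsilon>" for q
  proof -
    have "emeasure N (?B q) = emeasure (measure_pmf p) (- Q)"
      unfolding N_def by (rule emeasure_PiM_Collect_single) auto
    then show ?thesis using bad by (simp add: measure_def)
  qed
  have "measure N (\<Union>q\<in>?I. ?B q) \<le> (\<Sum>q\<in>?I. measure N (?B q))"
    by (rule N.finite_measure_subadditive_finite) (use one in auto)
  also have "\<dots> \<le> (\<Sum>q\<in>?I. \<epsilon>)" by (rule sum_mono) (rule mB)
  also have "\<dots> = real s * real (Suc r) * \<epsilon>" by (simp add: distrib_left)
  finally show "1 - real s * real (Suc r) * \<epsilon> \<le> measure N ?G"
    unfolding G using N.prob_compl[OF U] by simp
qed

section \<open>Runs of the algorithm\<close>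

locale ats_instance =
  fixes n1 n2 n3 r s w :: nat and A1 A2 A3 :: "real mat" and T :: "nat \<Rightarrow> nat \<Rightarrow> nat \<Rightarrow> real" and S :: "nat set"
  assumes A1: "A1 \<in> carrier_mat n1 r" "full_col_rank A1" and A2: "A2 \<in> carrier_mat n2 r" "full_col_rank A2"
    and A3: "A3 \<in> carrier_mat n3 r"
    and T: "\<forall>i1 < n1. \<forall>i2 < n2. \<forall>i3 < n3. T i1 i2 i3 = cp3 A1 A2 A3 i1 i2 i3"
    and S: "S \<subseteq> {..<n3}" "card S = s"
begin

definition Sl :: "nat list" where "Sl = sorted_list_of_set S"

definition c :: "nat \<Rightarrow> nat \<Rightarrow> real" where "c k l = A3 $$ (Sl ! k, l)"

lemma finite_S: "finite S"
  using S(1) finite_subset by blast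

lemma Sl_nth: "k < s \<Longrightarrow> Sl ! k < n3"
  using finite_S S nth_mem[of k Sl] by (auto simp: Sl_def)

lemma Sl_onto: "i \<in> S \<Longrightarrow> \<exists>k<s. Sl ! k = i"
  using finite_S S(2) in_set_conv_nth[of i Sl] by (auto simp: Sl_def)

lemma T_slice: "\<lbrakk>i1 < n1; i2 < n2; k < s\<rbrakk> \<Longrightarrow>
    T i1 i2 (Sl ! k) = (\<Sum>l<r. A1 $$ (i1, l) * A2 $$ (i2, l) * c k l)"
  using T A1(1) Sl_nth by (auto simp: cp3_def c_def)

lemma slice_colspace:
  assumes "p < n2" "k < s"
  shows "(\<lambda>a. T a p (Sl ! k)) \<in> colspace A1"
proof (rule colspaceI[OF A1(1)])
  fix i assume i: "i < n1"
  have cv: "vec r (\<lambda>l. A2 $$ (p, l) * c k l) \<in> carrier_vec r" by simp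
  show "T i p (Sl ! k) = (A1 *\<^sub>v vec r (\<lambda>l. A2 $$ (p, l) * c k l)) $ i"
    unfolding T_slice[OF i assms] mat_vec_index_sum[OF A1(1) cv i]
    by (rule sum.cong[OF refl]) (simp add: mult.assoc)
qed simp

context
  fixes Lams :: "nat \<times> nat \<Rightarrow> nat set" and u v :: "nat \<Rightarrow> real"
  assumes Lams: "\<forall>j<s. \<forall>k\<le>r. determining A1 (Lams (j, k)) \<and> Lams (j, k) \<subseteq> {..<n1} \<and> card (Lams (j, k)) = w"
    and gen: "generic s r c (u, v)"
begin

definition res :: "nat \<Rightarrow> real mat \<times> (nat \<times> nat) set" where
  "res j = amc n1 n2 (\<lambda>a i. T a i (Sl ! j)) (\<lambda>k. Lams (j, k))"

definition X :: "nat \<Rightarrow> nat \<Rightarrow> nat \<Rightarrow> real" where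
  "X i1 i2 j = fst (res j) $$ (i1, i2)"

lemma res_exact:
  assumes j: "j < s"
  shows "\<And>a i. a < n1 \<Longrightarrow> i < n2 \<Longrightarrow> X a i j = T a i (Sl ! j)"
    and "finite (snd (res j))" and "card (snd (res j)) \<le> n2 * w + r * n1"
proof -
  have L: "\<forall>k\<le>r. determining A1 (Lams (j, k)) \<and> Lams (j, k) \<subseteq> {..<n1} \<and> card (Lams (j, k)) = w"
    using Lams j by blast
  note ex = amc_exact[OF A1(1) slice_colspace[OF _ j] L, of n2]
  show "X a i j = T a i (Sl ! j)" if "a < n1" "i < n2" for a i
    unfolding X_def res_def by (rule ex(1)[OF _ that]) simp
  show "finite (snd (res j))" "card (snd (res j)) \<le> n2 * w + r * n1"
    unfolding res_def by (rule ex(2), simp, rule ex(3), simp)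
qed

lemma slice_comb_sandwich: "slice_comb n1 n2 s X u' = sandwich A1 (comb s c u') A2"
proof (rule eq_matI)
  note sc = sandwich_carrier[OF A1(1) A2(1), of "comb s c u'"]
  show "dim_row (slice_comb n1 n2 s X u') = dim_row (sandwich A1 (comb s c u') A2)"
    "dim_col (slice_comb n1 n2 s X u') = dim_col (sandwich A1 (comb s c u') A2)"
    using sc by (auto simp: slice_comb_def)
  fix i j assume "i < dim_row (sandwich A1 (comb s c u') A2)" "j < dim_col (sandwich A1 (comb s c u') A2)"
  then have ij: "i < n1" "j < n2" using sc by auto
  have "slice_comb n1 n2 s X u' $$ (i, j) = (\<Sum>k<s. u' k * X i j k)" using ij by (simp add: slice_comb_def)
  also have "\<dots> = (\<Sum>k<s. \<Sum>l<r. A1 $$ (i, l) * (u' k * c k l) * A2 $$ (j, l))"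
  proof (rule sum.cong[OF refl])
    fix k assume "k \<in> {..<s}"
    then have k: "k < s" by simp
    show "u' k * X i j k = (\<Sum>l<r. A1 $$ (i, l) * (u' k * c k l) * A2 $$ (j, l))"
      unfolding res_exact(1)[OF k ij] T_slice[OF ij k] sum_distrib_left
      by (rule sum.cong[OF refl]) (simp add: mult_ac)
  qed
  also have "\<dots> = (\<Sum>l<r. A1 $$ (i, l) * comb s c u' l * A2 $$ (j, l))"
    unfolding comb_def by (subst sum.swap) (simp add: sum_distrib_left sum_distrib_right)
  also have "\<dots> = sandwich A1 (comb s c u') A2 $$ (i, j)"
    by (rule sandwich_index[OF A1(1) A2(1) ij, symmetric])
  finally show "slice_comb n1 n2 s X u' $$ (i, j) = sandwich A1 (comb s c u') A2 $$ (i, j)" .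
qed

lemma generic_pencil_comb: "generic_pencil n1 n2 r A1 A2 (comb s c u) (comb s c v)"
proof
  have g: "comb s c u l \<noteq> 0" "comb s c v l \<noteq> 0" if "l < r" for l
    using gen that by (auto simp: generic_def)
  then show "\<forall>l<r. comb s c u l \<noteq> 0" "\<forall>l<r. comb s c v l \<noteq> 0" by auto
  show "inj_on (\<lambda>l. comb s c u l / comb s c v l) {..<r}"
  proof (rule inj_onI, rule ccontr)
    fix l m assume lm: "l \<in> {..<r}" "m \<in> {..<r}" "l \<noteq> m"
      and "comb s c u l / comb s c v l = comb s c u m / comb s c v m"
    then have "comb s c u l * comb s c v m = comb s c u m * comb s c v l"
      using g by (simp add: field_simps)
    moreover have "comb s c u l * comb s c v m \<noteq> comb s c u m * comb s c v l"
      using gen lm by (auto simp: generic_def)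
    ultimately show False by simp
  qed
qed (rule A1 A2)+

interpretation generic_pencil n1 n2 r A1 A2 "comb s c u" "comb s c v"
  by (rule generic_pencil_comb)

lemma ats_exec_iff:
  "ats_exec n1 n2 n3 w S T (Lams, u, v) B1 B2 B3 Obs \<longleftrightarrow> jennrich_out n1 n2 s X u v B1 B2 \<and>
     (\<exists>L. L \<subseteq> {..<n1} \<times> {..<n2} \<and> card L = dim_col B1 \<and> kr_rows_indep B1 B2 L \<and>
        B3 \<in> carrier_mat n3 (dim_col B1) \<and>
        (\<forall>i3 < n3. \<forall>(i1, i2) \<in> L. (\<Sum>l < dim_col B1. B1 $$ (i1, l) * B2 $$ (i2, l) * B3 $$ (i3, l)) = T i1 i2 i3) \<and>
        Obs = (\<Union>j < s. {(a, i, Sl ! j) | a i. (a, i) \<in> snd (res j)}) \<union> {(i1, i2, i3) | i1 i2 i3. (i1, i2) \<in> L \<and> i3 < n3})"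
proof -
  have "X = (\<lambda>i1 i2 j. fst (amc n1 n2 (\<lambda>a i. T a i (sorted_list_of_set S ! j)) (\<lambda>k. Lams (j, k))) $$ (i1, i2))"
    by (intro ext) (simp add: X_def res_def Sl_def)
  then show ?thesis unfolding ats_exec_def prod.case Let_def S(2) res_def Sl_def by simp
qed

text \<open>The true factors are themselves an admissible output, which keeps the claim about all
  runs from being vacuous.\<close>

lemma ats_exec_exists: "\<exists>B1 B2 B3 Obs. ats_exec n1 n2 n3 w S T (Lams, u, v) B1 B2 B3 Obs"
proof -
  obtain L where L: "L \<subseteq> {..<n1} \<times> {..<n2}" "card L = r" "kr_rows_indep A1 A2 L"
    using kr_row_selection[OF A1 A2] by blast
  have dc: "dim_col A1 = r" using A1(1) by simp
  have "\<forall>i3 < n3. \<forall>(i1, i2) \<in> L. (\<Sum>l < dim_col A1. A1 $$ (i1, l) * A2 $$ (i2, l) * A3 $$ (i3, l)) = T i1 i2 i3"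
    using T L(1) by (auto simp: cp3_def)
  then have "ats_exec n1 n2 n3 w S T (Lams, u, v) A1 A2 A3
      ((\<Union>j < s. {(a, i, Sl ! j) | a i. (a, i) \<in> snd (res j)}) \<union> {(i1, i2, i3) | i1 i2 i3. (i1, i2) \<in> L \<and> i3 < n3})"
    unfolding ats_exec_iff
    by (intro conjI exI[of _ L] jennrich_out_factors slice_comb_sandwich)
       (use L A3 dc in simp_all)
  then show ?thesis by blast
qed

lemma ats_exec_correct:
  assumes "ats_exec n1 n2 n3 w S T (Lams, u, v) B1 B2 B3 Obs"
  shows "\<forall>i1 < n1. \<forall>i2 < n2. \<forall>i3 < n3. cp3 B1 B2 B3 i1 i2 i3 = T i1 i2 i3"
    and "card Obs \<le> s * (n2 * w + r * n1) + r * n3"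
proof -
  obtain L where J: "jennrich_out n1 n2 s X u v B1 B2"
    and L: "L \<subseteq> {..<n1} \<times> {..<n2}" "card L = dim_col B1" "kr_rows_indep B1 B2 L"
    and B3: "\<forall>i3 < n3. \<forall>(i1, i2) \<in> L. (\<Sum>l < dim_col B1. B1 $$ (i1, l) * B2 $$ (i2, l) * B3 $$ (i3, l)) = T i1 i2 i3"
    and Obs: "Obs = (\<Union>j < s. {(a, i, Sl ! j) | a i. (a, i) \<in> snd (res j)}) \<union> {(i1, i2, i3) | i1 i2 i3. (i1, i2) \<in> L \<and> i3 < n3}"
    using assms unfolding ats_exec_iff by blast
  obtain \<sigma> \<gamma>1 \<gamma>2 where resc: "rescaled_factors n1 n2 r A1 A2 B1 B2 \<sigma> \<gamma>1 \<gamma>2"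
    using jennrich_out_rescaled[OF slice_comb_sandwich slice_comb_sandwich J] by blast
  show "\<forall>i1 < n1. \<forall>i2 < n2. \<forall>i3 < n3. cp3 B1 B2 B3 i1 i2 i3 = T i1 i2 i3"
    using cp3_recovered[OF A1(1) T resc L B3] by blast
  have "dim_col B1 = r" using resc by (auto simp: rescaled_factors_def)
  then have cL: "card L = r" using L(2) by simp
  have fL: "finite L" by (rule finite_subset[OF L(1)]) simp
  let ?R = "\<lambda>j. {(a, i, Sl ! j) | a i. (a, i) \<in> snd (res j)}"
  let ?Q = "{(i1, i2, i3) | i1 i2 i3. (i1, i2) \<in> L \<and> i3 < n3}"
  have cR: "card (?R j) \<le> n2 * w + r * n1" if j: "j < s" for j
  proof -
    have "?R j = (\<lambda>p. (fst p, snd p, Sl ! j)) ` snd (res j)" by force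
    then have "card (?R j) \<le> card (snd (res j))" using card_image_le[OF res_exact(2)[OF j]] by metis
    then show ?thesis using res_exact(3)[OF j] by simp
  qed
  have cU: "card (\<Union>j<s. ?R j) \<le> s * (n2 * w + r * n1)"
  proof -
    have "card (\<Union>j<s. ?R j) \<le> (\<Sum>j<s. card (?R j))" by (rule card_UN_le) simp
    also have "\<dots> \<le> (\<Sum>j<s. n2 * w + r * n1)" by (rule sum_mono) (use cR in simp)
    finally show ?thesis by simp
  qed
  have "?Q = (\<lambda>(p, k). (fst p, snd p, k)) ` (L \<times> {..<n3})" by force
  moreover have "card ((\<lambda>(p, k). (fst p, snd p, k)) ` (L \<times> {..<n3})) \<le> r * n3"
    using card_image_le[of "L \<times> {..<n3}" "\<lambda>(p, k). (fst p, snd p, k)"] fL cL by (simp add: card_cartesian_product)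
  ultimately have cQ: "card ?Q \<le> r * n3" by simp
  show "card Obs \<le> s * (n2 * w + r * n1) + r * n3"
    unfolding Obs using card_Un_le[of "\<Union>j<s. ?R j" ?Q] cU cQ by linarith
qed

end

lemma kruskal_c:
  assumes kr: "kruskal_rank (submatrix A3 S UNIV) \<ge> 2"
  shows "2 \<le> r"
    and "\<lbrakk>l < r; m < r; l \<noteq> m; \<forall>k<s. \<alpha> * c k l + \<beta> * c k m = 0\<rbrakk> \<Longrightarrow> \<alpha> = 0 \<and> \<beta> = 0"
proof -
  let ?M = "submatrix A3 S UNIV"
  have Sn: "{i. i < n3 \<and> i \<in> S} = S" and rr: "{j :: nat. j < r} = {..<r}" using S(1) by auto
  have M: "?M \<in> carrier_mat s r"
    using A3 S(2) Sn rr by (intro carrier_matI) (simp_all add: dim_submatrix)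
  show "2 \<le> r" by (rule kruskal_rank_ge_2(1)[OF M kr])
  assume lm: "l < r" "m < r" "l \<noteq> m" and eq: "\<forall>k<s. \<alpha> * c k l + \<beta> * c k m = 0"
  have "\<alpha> * ?M $$ (i, l) + \<beta> * ?M $$ (i, m) = 0" if i: "i < s" for i
  proof -
    \<comment> \<open>The submatrix numbers its rows by \<open>pick S\<close>, the algorithm its
      slices by \<open>Sl\<close>. To transfer a relation it suffices that every row occurs among
      the slices.\<close>
    have "pick S i \<in> S" using i S(2) by (intro pick_in_set_le) simp
    then obtain k where k: "k < s" "Sl ! k = pick S i" using Sl_onto by blast
    have "?M $$ (i, q) = c k q" if "q < r" for q
      using submatrix_index[of i A3 S q UNIV] i that S(2) A3 Sn rr k by (simp add: c_def pick_UNIV)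
    then show ?thesis using eq k(1) lm by simp
  qed
  then show "\<alpha> = 0 \<and> \<beta> = 0" by (intro kruskal_rank_ge_2(2)[OF M kr lm]) blast
qed

end

section \<open>Constants and the success event\<close>

lemma amc_w_le:
  assumes "0 < mu0" "2 \<le> r" "0 < \<delta>" "\<delta> < 1"
  shows "real (amc_w 3 mu0 r \<delta> n) \<le> 3 * of_int \<lceil>mu0 * real r * ln (real r / \<delta>)\<rceil>"
proof -
  define x where "x = mu0 * real r * ln (real r / \<delta>)"
  have "1 < real r / \<delta>" using assms by (simp add: field_simps)
  then have x: "0 < x" using assms by (simp add: x_def)
  have "3 * x \<le> of_int (3 * \<lceil>x\<rceil>)" by simp
  then have "\<lceil>3 * x\<rceil> \<le> 3 * \<lceil>x\<rceil>" by (simp only: ceiling_le_iff)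
  moreover have "amc_w 3 mu0 r \<delta> n \<le> nat \<lceil>3 * x\<rceil>"
    unfolding amc_w_def x_def by (simp add: mult.assoc)
  moreover have "0 \<le> \<lceil>3 * x\<rceil>" using x by simp
  ultimately have "int (amc_w 3 mu0 r \<delta> n) \<le> 3 * \<lceil>x\<rceil>" by linarith
  then have "real_of_int (int (amc_w 3 mu0 r \<delta> n)) \<le> of_int (3 * \<lceil>x\<rceil>)" by (simp only: of_int_le_iff)
  then show ?thesis by (simp add: x_def)
qed

text \<open>The cube leaves (r + 1) / r^2 times \<delta>^3, and r + 1 is at most r^2 from 2 on. A
  square would leave (r + 1) / r times \<delta>^2, which exceeds \<delta> when \<delta> is close to
  1; hence the constant 3 in the sample size.\<close>

lemma union_bound_le:
  assumes "2 \<le> r" "0 < \<delta>" "\<delta> < (1 :: real)"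
  shows "real s * real (Suc r) * (real r * (\<delta> / real r) ^ 3) \<le> real s * \<delta>"
proof -
  have r: "2 \<le> real r" using assms(1) by simp
  then have "2 * real r \<le> real r * real r" by (intro mult_right_mono) auto
  then have "real (Suc r) \<le> real r * real r" using r unfolding of_nat_Suc by linarith
  then have 1: "real (Suc r) / (real r * real r) \<le> 1" using assms(1) by (simp add: divide_le_eq)
  have "\<delta> ^ 3 \<le> \<delta> ^ 1" using assms by (intro power_decreasing) auto
  then have 2: "\<delta> ^ 3 \<le> \<delta>" by simp
  have "real (Suc r) * (real r * (\<delta> / real r) ^ 3) = real (Suc r) / (real r * real r) * \<delta> ^ 3"
    using assms(1) by (simp add: power3_eq_cube field_simps)
  also have "\<dots> \<le> 1 * \<delta>" using 1 2 assms by (intro mult_mono) auto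
  finally have "real (Suc r) * (real r * (\<delta> / real r) ^ 3) \<le> \<delta>" by simp
  then show ?thesis unfolding mult.assoc by (intro mult_left_mono) auto
qed

lemma ats_success:
  fixes n1 n2 n3 r s :: nat and S :: "nat set"
  assumes A: "A1 \<in> carrier_mat n1 r" "A2 \<in> carrier_mat n2 r" "A3 \<in> carrier_mat n3 r"
    and T: "\<forall>i1 < n1. \<forall>i2 < n2. \<forall>i3 < n3. T i1 i2 i3 = cp3 A1 A2 A3 i1 i2 i3"
    and \<delta>: "0 < \<delta>" "\<delta> < 1" and mu0: "0 < mu0" and coh: "coherence A1 \<le> mu0"
    and rk: "mrank A1 = r" "mrank A2 = r"
    and kr: "kruskal_rank (submatrix A3 S UNIV) \<ge> 2"
    and S: "S \<subseteq> {..<n3}" "card S = s"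
  defines "w \<equiv> amc_w 3 mu0 r \<delta> n1"
  shows "\<exists>E \<in> sets (ats_space n1 w s). measure (ats_space n1 w s) E \<ge> 1 - real s * \<delta> \<and>
        (\<forall>om \<in> E.
           (\<exists>B1 B2 B3 Obs. ats_exec n1 n2 n3 w S T om B1 B2 B3 Obs) \<and>
           (\<forall>B1 B2 B3 Obs. ats_exec n1 n2 n3 w S T om B1 B2 B3 Obs \<longrightarrow>
              (\<forall>i1 < n1. \<forall>i2 < n2. \<forall>i3 < n3. cp3 B1 B2 B3 i1 i2 i3 = T i1 i2 i3) \<and>
              real (card Obs) \<le> 3 * real s * real n2 * of_int \<lceil>mu0 * real r * ln (real r / \<delta>)\<rceil>
                                 + real s * real n1 * real r + real n3 * real r))"
proof -
  have f1: "full_col_rank A1" and f2: "full_col_rank A2"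
    using mrank_full_col_rank[OF A(1) rk(1)] mrank_full_col_rank[OF A(2) rk(2)] .
  interpret ats_instance n1 n2 n3 r s w A1 A2 A3 T S
    by unfold_locales (fact A f1 f2 T S)+
  note r2 = kruskal_c(1)[OF kr]
  have r0: "0 < r" using r2 by simp
  have n1: "0 < n1" using full_col_rank_col_nonzero[OF A(1) f1 r0] by auto
  define Q where "Q = {\<Lambda>. determining A1 \<Lambda> \<and> \<Lambda> \<subseteq> {..<n1} \<and> card \<Lambda> = w}"
  define p where "p = pmf_of_set {\<Lambda>. \<Lambda> \<subseteq> {..<n1} \<and> card \<Lambda> = w}"
  define N where "N = PiM UNIV (\<lambda>_ :: nat \<times> nat. measure_pmf p)"
  define G where "G = PiM {..<s} (\<lambda>_ :: nat. std_normal)"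
  have space: "ats_space n1 w s = N \<Otimes>\<^sub>M (G \<Otimes>\<^sub>M G)" unfolding ats_space_def N_def p_def G_def ..
  have bad: "measure (measure_pmf p) (- Q) \<le> real r * (\<delta> / real r) ^ 3"
    using prob_not_determining[OF A(1) n1 r0 mu0 \<delta>(1) coh w_def[THEN meta_eq_to_obj_eq]]
    unfolding p_def Q_def Collect_neg_eq .
  interpret G: prob_space G unfolding G_def by (rule prob_space_PiM_std_normal)
  interpret N: prob_space N unfolding N_def by (rule prob_space_PiM) (rule measure_pmf.prob_space_axioms)
  interpret GG: pair_prob_space G G ..
  define EL where "EL = {f \<in> space N. \<forall>j<s. \<forall>k\<le>r. f (j, k) \<in> Q}"
  define EG where "EG = {z \<in> space (G \<Otimes>\<^sub>M G). generic s r c z}"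
  note draws = prob_all_draws[OF bad, where s = s and r = r, folded N_def, folded EL_def]
  have EG: "EG \<in> sets (G \<Otimes>\<^sub>M G)"
    unfolding EG_def G_def by (rule AE_generic(1)[OF r2]) (rule kruskal_c(2)[OF kr]; assumption)
  have gen: "AE z in G \<Otimes>\<^sub>M G. generic s r c z"
    unfolding G_def by (rule AE_generic(2)[OF r2]) (rule kruskal_c(2)[OF kr]; assumption)
  \<comment> \<open>The Gaussian part costs no probability, so the product event is exactly as
    likely as the good draws.\<close>
  have "emeasure (G \<Otimes>\<^sub>M G) EG = 1"
  proof (rule GG.P.emeasure_eq_1_AE[OF EG])
    show "AE z in G \<Otimes>\<^sub>M G. z \<in> EG"
      using gen AE_space[of "G \<Otimes>\<^sub>M G"] by eventually_elim (simp add: EG_def)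
  qed
  then have "emeasure (N \<Otimes>\<^sub>M (G \<Otimes>\<^sub>M G)) (EL \<times> EG) = emeasure N EL"
    using GG.P.emeasure_pair_measure_Times[OF draws(1) EG] by simp
  then have m: "measure (N \<Otimes>\<^sub>M (G \<Otimes>\<^sub>M G)) (EL \<times> EG) = measure N EL" by (simp add: measure_def)
  have "1 - real s * \<delta> \<le> measure N EL"
    using draws(2) union_bound_le[OF r2 \<delta>, of s] by linarith
  then have prob: "1 - real s * \<delta> \<le> measure (ats_space n1 w s) (EL \<times> EG)" unfolding space m .
  have meas: "EL \<times> EG \<in> sets (ats_space n1 w s)" unfolding space by (rule pair_measureI[OF draws(1) EG])
  show ?thesis
  proof (intro bexI[OF _ meas] conjI prob ballI)
    fix om assume om: "om \<in> EL \<times> EG"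
    obtain Lams u v where omd: "om = (Lams, u, v)" by (cases om)
    have L: "\<forall>j<s. \<forall>k\<le>r. determining A1 (Lams (j, k)) \<and> Lams (j, k) \<subseteq> {..<n1} \<and> card (Lams (j, k)) = w"
      using om by (simp add: omd EL_def Q_def)
    have g: "generic s r c (u, v)" using om by (simp add: omd EG_def)
    show "\<exists>B1 B2 B3 Obs. ats_exec n1 n2 n3 w S T om B1 B2 B3 Obs"
      unfolding omd by (rule ats_exec_exists[OF L g])
    show "\<forall>B1 B2 B3 Obs. ats_exec n1 n2 n3 w S T om B1 B2 B3 Obs \<longrightarrow>
              (\<forall>i1 < n1. \<forall>i2 < n2. \<forall>i3 < n3. cp3 B1 B2 B3 i1 i2 i3 = T i1 i2 i3) \<and>
              real (card Obs) \<le> 3 * real s * real n2 * of_int \<lceil>mu0 * real r * ln (real r / \<delta>)\<rceil>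
                                 + real s * real n1 * real r + real n3 * real r"
    proof (intro allI impI)
      fix B1 B2 B3 Obs assume "ats_exec n1 n2 n3 w S T om B1 B2 B3 Obs"
      note ex = ats_exec_correct[OF L g this[unfolded omd]]
      have "real (card Obs) \<le> real (s * (n2 * w + r * n1) + r * n3)" using ex(2) by (simp only: of_nat_le_iff)
      also have "\<dots> = real s * real n2 * real w + real s * real n1 * real r + real n3 * real r"
        by (simp add: algebra_simps)
      also have "real s * real n2 * real w \<le> real s * real n2 * (3 * of_int \<lceil>mu0 * real r * ln (real r / \<delta>)\<rceil>)"
        using amc_w_le[OF mu0 r2 \<delta>, of n1] unfolding w_def by (intro mult_left_mono) auto
      finally have "real (card Obs) \<le> 3 * real s * real n2 * of_int \<lceil>mu0 * real r * ln (real r / \<delta>)\<rceil>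
                                 + real s * real n1 * real r + real n3 * real r"
        by (simp add: mult_ac)
      with ex(1) show "(\<forall>i1 < n1. \<forall>i2 < n2. \<forall>i3 < n3. cp3 B1 B2 B3 i1 i2 i3 = T i1 i2 i3) \<and>
              real (card Obs) \<le> 3 * real s * real n2 * of_int \<lceil>mu0 * real r * ln (real r / \<delta>)\<rceil>
                                 + real s * real n1 * real r + real n3 * real r" by blast
    qed
  qed
qed

theorem theorem1:
  "\<exists>C > 0. \<exists>K :: real. \<forall>(n1::nat) (n2::nat) (n3::nat) (r::nat) (s::nat) (\<delta>::real) (mu0::real)
     (A1::real mat) (A2::real mat) (A3::real mat) (T::nat \<Rightarrow> nat \<Rightarrow> nat \<Rightarrow> real) (S::nat set).
     A1 \<in> carrier_mat n1 r \<and> A2 \<in> carrier_mat n2 r \<and> A3 \<in> carrier_mat n3 r \<and>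
     (\<forall>i1 < n1. \<forall>i2 < n2. \<forall>i3 < n3. T i1 i2 i3 = cp3 A1 A2 A3 i1 i2 i3) \<and>
     s \<ge> 1 \<and> 0 < \<delta> \<and> \<delta> < 1 \<and> 0 < mu0 \<and>
     coherence A1 \<le> mu0 \<and>
     mrank A1 = r \<and> mrank A2 = r \<and>
     (\<forall>I. I \<subseteq> {..<n3} \<and> card I = s \<longrightarrow> kruskal_rank (submatrix A3 I UNIV) \<ge> 2) \<and>
     S \<subseteq> {..<n3} \<and> card S = s
     \<longrightarrow>
     (let w = amc_w C mu0 r \<delta> n1; P = ats_space n1 w s in
      \<exists>E \<in> sets P. measure P E \<ge> 1 - real s * \<delta> \<and>
        (\<forall>om \<in> E.
           (\<exists>B1 B2 B3 Obs. ats_exec n1 n2 n3 w S T om B1 B2 B3 Obs) \<and>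
           (\<forall>B1 B2 B3 Obs. ats_exec n1 n2 n3 w S T om B1 B2 B3 Obs \<longrightarrow>
              (\<forall>i1 < n1. \<forall>i2 < n2. \<forall>i3 < n3. cp3 B1 B2 B3 i1 i2 i3 = T i1 i2 i3) \<and>
              real (card Obs) \<le> K * real s * real n2 * of_int \<lceil>mu0 * real r * ln (real r / \<delta>)\<rceil>
                                 + real s * real n1 * real r + real n3 * real r)))"
proof (rule exI[of _ 3], rule conjI, simp, rule exI[of _ 3], intro allI impI)
  \<comment> \<open>\<open>C\<close> is 3 because of the union bound; \<open>K\<close> is the same
    3, pulled out of the ceiling in the sample count by \<open>amc_w_le\<close>.\<close>
  fix n1 n2 n3 r s :: nat and \<delta> mu0 :: real and A1 A2 A3 :: "real mat"
    and T :: "nat \<Rightarrow> nat \<Rightarrow> nat \<Rightarrow> real" and S :: "nat set"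
  assume h: "A1 \<in> carrier_mat n1 r \<and> A2 \<in> carrier_mat n2 r \<and> A3 \<in> carrier_mat n3 r \<and>
     (\<forall>i1 < n1. \<forall>i2 < n2. \<forall>i3 < n3. T i1 i2 i3 = cp3 A1 A2 A3 i1 i2 i3) \<and>
     s \<ge> 1 \<and> 0 < \<delta> \<and> \<delta> < 1 \<and> 0 < mu0 \<and>
     coherence A1 \<le> mu0 \<and>
     mrank A1 = r \<and> mrank A2 = r \<and>
     (\<forall>I. I \<subseteq> {..<n3} \<and> card I = s \<longrightarrow> kruskal_rank (submatrix A3 I UNIV) \<ge> 2) \<and>
     S \<subseteq> {..<n3} \<and> card S = s"
  show "let w = amc_w 3 mu0 r \<delta> n1; P = ats_space n1 w s in
      \<exists>E \<in> sets P. measure P E \<ge> 1 - real s * \<delta> \<and>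
        (\<forall>om \<in> E.
           (\<exists>B1 B2 B3 Obs. ats_exec n1 n2 n3 w S T om B1 B2 B3 Obs) \<and>
           (\<forall>B1 B2 B3 Obs. ats_exec n1 n2 n3 w S T om B1 B2 B3 Obs \<longrightarrow>
              (\<forall>i1 < n1. \<forall>i2 < n2. \<forall>i3 < n3. cp3 B1 B2 B3 i1 i2 i3 = T i1 i2 i3) \<and>
              real (card Obs) \<le> 3 * real s * real n2 * of_int \<lceil>mu0 * real r * ln (real r / \<delta>)\<rceil>
                                 + real s * real n1 * real r + real n3 * real r))"
    unfolding Let_def
  proof (rule ats_success[where ?A1.0 = A1 and ?A2.0 = A2 and ?A3.0 = A3])
    show "kruskal_rank (submatrix A3 S UNIV) \<ge> 2" using h by blast
  qed (use h in simp_all)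
qed

end
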